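(* Let $\mathcal V$ be a completely distributive quantale. Consider the adjunctions $\tilde\varepsilon\dashv R$ between $(U,\mathcal V)\text{-}\mathsf{Cat}$ and $\mathcal V\text{-}\mathsf{Cls}$, and between $(U,\mathcal V)\text{-}\mathsf{UGph}$ and $\mathcal V\text{-}\mathsf{PreCls}$, given on objects by $\tilde\varepsilon(A,\alpha)=(A,(S,x)\mapsto\sup_{\mathfrak x\ni S}\alpha(\mathfrak x,x))$ and $R(A,\delta)=(A,(\mathfrak x,x)\mapsto\inf_{S\in\mathfrak x}\delta(S,x))$ and leaving morphisms unchanged. They lift, leaving $\mathcal V$-category structures unchanged, to adjunctions $\bar{\tilde\varepsilon}\dashv\bar R$ with $\bar{\tilde\varepsilon}\colon(U,\mathcal V)\text{-}\mathsf{ModCat}\to\mathcal V\text{-}\mathsf{ModCls}$ and $\bar{\tilde\varepsilon}\colon(U,\mathcal V)\text{-}\mathsf{ModUGph}\to\mathcal V\text{-}\mathsf{ModPreCls}$ respectively. Writing $W$ for each of the forgetful functors that forget $\mathcal V$-category structures, and $N$ for each of the normalisation functors $N\colon(U,\mathcal V)\text{-}\mathsf{Cat}\to(U,\mathcal V)\text{-}\mathsf{ModCat}$ and $N\colon\mathcal V\text{-}\mathsf{Cls}\to\mathcal V\text{-}\mathsf{ModCls}$ (so that $W\dashv N$ in both cases), one has $$W\circ\bar{\tilde\varepsilon}=\tilde\varepsilon\circ W\quad\text{and}\quad W\circ\bar R=R\circ W$$ in both the category/closure case and the unitary graph/preclosure case, and $\bar{\tilde\varepsilon}\circ N=N\circ\tilde\varepsilon$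 as functors $(U,\mathcal V)\text{-}\mathsf{Cat}\to\mathcal V\text{-}\mathsf{ModCls}$. Moreover the lifts establish isomorphisms of categories $$(U,\mathcal V)\text{-}\mathsf{ModCat}\cong\mathcal V\text{-}\mathsf{ModTop}\qquad\text{and}\qquad(U,\mathcal V)\text{-}\mathsf{ModUGph}\cong\mathcal V\text{-}\mathsf{ModPreTop}.$$
   Context: A quantale $\mathcal V=(\mathcal V,\otimes,k)$ is a complete lattice with a (not necessarily commutative) monoid structure $\otimes$ with unit $k$ such that $\otimes$ preserves suprema in each variable; $\bot$ is its bottom element. It is completely distributive if the map $\sup$ from the set of downsets of $\mathcal V$ (ordered by inclusion) to $\mathcal V$ has a left adjoint. A $\mathcal V$-relation $J\colon A\nrightarrow B$ is a function $J\colon A\times B\to\mathcal V$; composition is $(J\odot H)(x,z)=\sup_yJ(x,y)\otimes H(y,z)$, and $\mathcal V$-relations are ordered pointwise. A $\mathcal V$-category is a set $A$ with a $\mathcal V$-relation $\bar A\colon A\nrightarrow A$ such that $k\le\bar A(x,x)$ and $\bar A\odot\bar A\le\bar A$; a $\mathcal V$-functor $f\colon A\to C$ satisfies $\bar A(x,y)\le\bar C(fx,fy)$. $PA$ is the powerset of $A$ and $UA$ its set of ultrafilters. $(Pf)(S)=fS$, and $(Uf)(\mathfrak x)=\{T\subseteq C\mid f^{-1}T\in\mathfrak x\}$ for $f\colon A\to C$; $\iota_A(x)$ is the principal ultrafilter on $x$; for $\mathfrak X\in U^2A$, $\mu_A(\mathfrak X)=\{S\subseteq A\mid S^\sharp\in\mathfrak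 X\}$ where $S^\sharp=\{\mathfrak x\in UA\mid S\in\mathfrak x\}$. For $J\colon A\nrightarrow B$ put $(PJ)(S,T)=\inf_{t\in T}\sup_{s\in S}J(s,t)$ and $(UJ)(\mathfrak x,\mathfrak y)=\inf_{S\in\mathfrak x,T\in\mathfrak y}\sup_{s\in S,t\in T}J(s,t)$. A unitary $(U,\mathcal V)$-graph is a set $A$ with $\alpha\colon UA\nrightarrow A$ such that $k\le\alpha(\iota_A(x),x)$ and $(U\alpha)(\mathfrak X,\iota_A(x))\le\alpha(\mu_A(\mathfrak X),x)$. A $(U,\mathcal V)$-category is $(A,\alpha)$ with $k\le\alpha(\iota_A(x),x)$ and $(U\alpha\odot\alpha)(\mathfrak X,x)\le\alpha(\mu_A(\mathfrak X),x)$. Morphisms $f\colon(A,\alpha)\to(C,\gamma)$ satisfy $\alpha(\mathfrak x,x)\le\gamma((Uf)(\mathfrak x),fx)$. The categories are $(U,\mathcal V)\text{-}\mathsf{UGph}$ and $(U,\mathcal V)\text{-}\mathsf{Cat}$. A $\mathcal V$-valued preclosure space is a set $A$ with $\delta\colon PA\nrightarrow A$ such that $k\le\delta(\{x\},x)$, and $S\subseteq T$ implies $\delta(S,x)\le\delta(T,x)$. A $\mathcal V$-valued closure space is $(A,\delta)$ with $k\le\delta(\{x\},x)$ and $(P\delta\odot\delta)(\Sigma,x)\le\delta(\bigcup\Sigma,x)$ for all $\Sigma\in P^2A$, $x\in A$. Morphisms $f\colon(A,\delta)\to(C,\zeta)$ are continuous maps: $\delta(S,x)\le\zeta(fS,fx)$.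 The categories are $\mathcal V\text{-}\mathsf{PreCls}$ and $\mathcal V\text{-}\mathsf{Cls}$. The modular versions: $(U,\mathcal V)\text{-}\mathsf{ModUGph}$ (resp. $(U,\mathcal V)\text{-}\mathsf{ModCat}$) has as objects triples $(A,\bar A,\alpha)$ with $(A,\bar A)$ a $\mathcal V$-category and $(A,\alpha)$ a unitary $(U,\mathcal V)$-graph (resp. a $(U,\mathcal V)$-category) such that $U\bar A\odot\alpha\odot\bar A\le\alpha$; $\mathcal V\text{-}\mathsf{ModPreCls}$ (resp. $\mathcal V\text{-}\mathsf{ModCls}$) has as objects triples $(A,\bar A,\delta)$ with $(A,\bar A)$ a $\mathcal V$-category and $(A,\delta)$ a $\mathcal V$-valued preclosure (resp. closure) space such that $P\bar A\odot\delta\odot\bar A\le\delta$. In all cases morphisms are maps that are both $\mathcal V$-functors and morphisms of the unstructured kind. $\mathcal V\text{-}\mathsf{ModTop}\subseteq\mathcal V\text{-}\mathsf{ModCls}$ and $\mathcal V\text{-}\mathsf{ModPreTop}\subseteq\mathcal V\text{-}\mathsf{ModPreCls}$ are the full subcategories on objects whose $\delta$ preserves finite joins: $\delta(\emptyset,x)=\bot$ and $\delta(S\cup T,x)=\sup\{\delta(S,x),\delta(T,x)\}$. The functors $N$, which leave morphisms unchanged, are given by $N(A,\alpha)=(A,\bar A,\alpha)$ with $\bar A(x,y)=\alpha(\iota_A(x),y)$, and $N(A,\delta)=(A,\bar A,\delta)$ with $\bar A(x,y)=\delta(\{x\},y)$. *)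

theory Defs
  imports Main "HOL-Library.FuncSet"
begin

section \<open>Categories, functors and adjunctions\<close>

record ('o, 'm) precat =
  Obj :: "'o set"
  Hom :: "'o \<Rightarrow> 'o \<Rightarrow> 'm set"
  Id :: "'o \<Rightarrow> 'm"
  Comp :: "'o \<Rightarrow> 'o \<Rightarrow> 'o \<Rightarrow> 'm \<Rightarrow> 'm \<Rightarrow> 'm"

text \<open>\<open>Comp C X Y Z g f\<close> is the composite of \<open>f : X \<rightarrow> Y\<close> followed by \<open>g : Y \<rightarrow> Z\<close>.\<close>

locale category =
  fixes C :: "('o, 'm) precat"
  assumes Id_in_Hom: "X \<in> Obj C \<Longrightarrow> Id C X \<in> Hom C X X"
    and Comp_in_Hom:
      "\<lbrakk>X \<in> Obj C; Y \<in> Obj C; Z \<in> Obj C; f \<in> Hom C X Y; g \<in> Hom C Y Z\<rbrakk>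
        \<Longrightarrow> Comp C X Y Z g f \<in> Hom C X Z"
    and Id_left:
      "\<lbrakk>X \<in> Obj C; Y \<in> Obj C; f \<in> Hom C X Y\<rbrakk> \<Longrightarrow> Comp C X Y Y (Id C Y) f = f"
    and Id_right:
      "\<lbrakk>X \<in> Obj C; Y \<in> Obj C; f \<in> Hom C X Y\<rbrakk> \<Longrightarrow> Comp C X X Y f (Id C X) = f"
    and Comp_assoc:
      "\<lbrakk>X \<in> Obj C; Y \<in> Obj C; Z \<in> Obj C; V \<in> Obj C;
        f \<in> Hom C X Y; g \<in> Hom C Y Z; h \<in> Hom C Z V\<rbrakk>
        \<Longrightarrow> Comp C X Z V h (Comp C X Y Z g f) = Comp C X Y V (Comp C Y Z V h g) f"

definition full_subcat :: "('o, 'm) precat \<Rightarrow> ('o \<Rightarrow> bool) \<Rightarrow> ('o, 'm) precat" where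
  "full_subcat C P = C\<lparr>Obj := {X \<in> Obj C. P X}\<rparr>"

record ('o, 'm, 'p, 'n) ftor =
  Fob :: "'o \<Rightarrow> 'p"
  Far :: "'o \<Rightarrow> 'o \<Rightarrow> 'm \<Rightarrow> 'n"

locale cat_functor = dom: category C + cod: category D
  for C :: "('o, 'm) precat" and D :: "('p, 'n) precat" +
  fixes F :: "('o, 'm, 'p, 'n) ftor"
  assumes Fob_in_Obj: "X \<in> Obj C \<Longrightarrow> Fob F X \<in> Obj D"
    and Far_in_Hom:
      "\<lbrakk>X \<in> Obj C; Y \<in> Obj C; f \<in> Hom C X Y\<rbrakk>
        \<Longrightarrow> Far F X Y f \<in> Hom D (Fob F X) (Fob F Y)"
    and Far_Id: "X \<in> Obj C \<Longrightarrow> Far F X X (Id C X) = Id D (Fob F X)"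
    and Far_Comp:
      "\<lbrakk>X \<in> Obj C; Y \<in> Obj C; Z \<in> Obj C; f \<in> Hom C X Y; g \<in> Hom C Y Z\<rbrakk>
        \<Longrightarrow> Far F X Z (Comp C X Y Z g f)
          = Comp D (Fob F X) (Fob F Y) (Fob F Z) (Far F Y Z g) (Far F X Y f)"

definition fid :: "('o, 'm, 'o, 'm) ftor" where
  "fid = \<lparr>Fob = (\<lambda>X. X), Far = (\<lambda>X Y f. f)\<rparr>"

definition fcomp ::
  "('p, 'n, 'q, 'l) ftor \<Rightarrow> ('o, 'm, 'p, 'n) ftor \<Rightarrow> ('o, 'm, 'q, 'l) ftor"
  (infixr \<open>\<circ>\<^sub>F\<close> 55) where
  "G \<circ>\<^sub>F F = \<lparr>Fob = (\<lambda>X. Fob G (Fob F X)),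
               Far = (\<lambda>X Y f. Far G (Fob F X) (Fob F Y) (Far F X Y f))\<rparr>"

text \<open>Strict equality of two functors \<open>C \<rightarrow> D\<close>. The records are total functions, so their
  values outside the objects and morphisms of \<open>C\<close> have to be disregarded.\<close>

definition functor_eq ::
  "('o, 'm) precat \<Rightarrow> ('p, 'n) precat \<Rightarrow> ('o, 'm, 'p, 'n) ftor \<Rightarrow> ('o, 'm, 'p, 'n) ftor \<Rightarrow> bool"
  where
  "functor_eq C D F G \<longleftrightarrow> cat_functor C D F \<and> cat_functor C D G \<and>
     (\<forall>X\<in>Obj C. Fob F X = Fob G X) \<and>
     (\<forall>X\<in>Obj C. \<forall>Y\<in>Obj C. \<forall>f\<in>Hom C X Y. Far F X Y f = Far G X Y f)"

locale nat_trans = source: cat_functor C D F + target: cat_functor C D G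
  for C :: "('o, 'm) precat" and D :: "('p, 'n) precat"
    and F :: "('o, 'm, 'p, 'n) ftor" and G :: "('o, 'm, 'p, 'n) ftor" +
  fixes \<tau> :: "'o \<Rightarrow> 'n"
  assumes component_in_Hom: "X \<in> Obj C \<Longrightarrow> \<tau> X \<in> Hom D (Fob F X) (Fob G X)"
    and naturality:
      "\<lbrakk>X \<in> Obj C; Y \<in> Obj C; f \<in> Hom C X Y\<rbrakk>
        \<Longrightarrow> Comp D (Fob F X) (Fob F Y) (Fob G Y) (\<tau> Y) (Far F X Y f)
          = Comp D (Fob F X) (Fob G X) (Fob G Y) (Far G X Y f) (\<tau> X)"

text \<open>\<open>F \<stileturn> G\<close> with \<open>F : C \<rightarrow> D\<close>, \<open>G : D \<rightarrow> C\<close>, unit \<open>\<eta>\<close> and counit \<open>\<theta>\<close>.\<close>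

locale adjunction =
  left: cat_functor C D F + right: cat_functor D C G +
  unit: nat_trans C C fid "G \<circ>\<^sub>F F" \<eta> + counit: nat_trans D D "F \<circ>\<^sub>F G" fid \<theta>
  for C :: "('o, 'm) precat" and D :: "('p, 'n) precat"
    and F :: "('o, 'm, 'p, 'n) ftor" and G :: "('p, 'n, 'o, 'm) ftor"
    and \<eta> :: "'o \<Rightarrow> 'm" and \<theta> :: "'p \<Rightarrow> 'n" +
  assumes triangle_left:
      "X \<in> Obj C \<Longrightarrow>
        Comp D (Fob F X) (Fob F (Fob G (Fob F X))) (Fob F X)
          (\<theta> (Fob F X)) (Far F X (Fob G (Fob F X)) (\<eta> X)) = Id D (Fob F X)"
    and triangle_right:
      "Y \<in> Obj D \<Longrightarrow>
        Comp C (Fob G Y) (Fob G (Fob F (Fob G Y))) (Fob G Y)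
          (Far G (Fob F (Fob G Y)) Y (\<theta> Y)) (\<eta> (Fob G Y)) = Id C (Fob G Y)"

definition cat_iso ::
  "('o, 'm) precat \<Rightarrow> ('p, 'n) precat \<Rightarrow> ('o, 'm, 'p, 'n) ftor \<Rightarrow> ('p, 'n, 'o, 'm) ftor \<Rightarrow> bool"
  where
  "cat_iso C D F G \<longleftrightarrow> cat_functor C D F \<and> cat_functor D C G \<and>
     functor_eq C C (G \<circ>\<^sub>F F) fid \<and> functor_eq D D (F \<circ>\<^sub>F G) fid"

text \<open>Categories of structured sets. An object \<open>X\<close> is a set \<open>fst X\<close> of elements of a fixed but
  arbitrary type \<open>'a\<close>, paired with a structure on it. Maps are extensional (they take the value
  \<open>undefined\<close> outside their domain), so that equality of morphisms is equality in HOL.\<close>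

definition set_cat ::
  "('a set \<times> 's) set \<Rightarrow> ('a set \<times> 's \<Rightarrow> 'a set \<times> 's \<Rightarrow> ('a \<Rightarrow> 'a) \<Rightarrow> bool)
    \<Rightarrow> ('a set \<times> 's, 'a \<Rightarrow> 'a) precat" where
  "set_cat Ob mor =
     \<lparr>Obj = Ob,
      Hom = (\<lambda>X Y. {f \<in> fst X \<rightarrow>\<^sub>E fst Y. mor X Y f}),
      Id = (\<lambda>X. \<lambda>x\<in>fst X. x),
      Comp = (\<lambda>X Y Z g f. compose (fst X) g f)\<rparr>"

definition set_ftor :: "('o \<Rightarrow> 'p) \<Rightarrow> ('o, 'a \<Rightarrow> 'a, 'p, 'a \<Rightarrow> 'a) ftor" where
  "set_ftor F = \<lparr>Fob = F, Far = (\<lambda>X Y f. f)\<rparr>"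

definition idmap :: "'a set \<times> 's \<Rightarrow> 'a \<Rightarrow> 'a" where
  "idmap X = (\<lambda>x\<in>fst X. x)"


section \<open>Quantales\<close>

text \<open>The tensor product is written \<open>*\<close> and its unit \<open>k\<close> is written \<open>1\<close>.\<close>

class quantale = complete_lattice + monoid_mult +
  assumes Sup_mult_distrib: "Sup X * y = (SUP x\<in>X. x * y)"
    and mult_Sup_distrib: "x * Sup Y = (SUP y\<in>Y. x * y)"

definition is_downset :: "'v::order set \<Rightarrow> bool" where
  "is_downset D \<longleftrightarrow> (\<forall>x\<in>D. \<forall>y. y \<le> x \<longrightarrow> y \<in> D)"

text \<open>\<open>L\<close> is a left adjoint of \<open>Sup\<close>, from the downsets ordered by inclusion to \<open>'v\<close>.\<close>

definition completely_distributive :: "'v::complete_lattice itself \<Rightarrow> bool" where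
  "completely_distributive _ \<longleftrightarrow>
     (\<exists>L :: 'v \<Rightarrow> 'v set. mono L \<and> (\<forall>v. is_downset (L v)) \<and>
        (\<forall>v D. is_downset D \<longrightarrow> (L v \<subseteq> D \<longleftrightarrow> v \<le> Sup D)))"


section \<open>Relations and categories enriched in a quantale\<close>

text \<open>Relations are extensional functions on the product of the underlying sets, so that equality
  of structures on a set is equality in HOL.\<close>

type_synonym ('x, 'y, 'v) vrel = "'x \<times> 'y \<Rightarrow> 'v"

definition vrels :: "'x set \<Rightarrow> 'y set \<Rightarrow> ('x, 'y, 'v) vrel set" where
  "vrels A B = extensional (A \<times> B)"

definition vle :: "'x set \<Rightarrow> 'y set \<Rightarrow> ('x, 'y, 'v::order) vrel \<Rightarrow> ('x, 'y, 'v) vrel \<Rightarrow> bool" where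
  "vle A B J H \<longleftrightarrow> (\<forall>x\<in>A. \<forall>y\<in>B. J (x, y) \<le> H (x, y))"

text \<open>\<open>vcomp A B E J H\<close> is \<open>J \<odot> H\<close> for \<open>J : A \<nrightarrow> B\<close> and \<open>H : B \<nrightarrow> E\<close>.\<close>

definition vcomp ::
  "'x set \<Rightarrow> 'y set \<Rightarrow> 'z set \<Rightarrow> ('x, 'y, 'v::quantale) vrel \<Rightarrow> ('y, 'z, 'v) vrel \<Rightarrow> ('x, 'z, 'v) vrel"
  where
  "vcomp A B E J H = (\<lambda>(x, z)\<in>A \<times> E. SUP y\<in>B. J (x, y) * H (y, z))"

definition vcategory :: "'a set \<Rightarrow> ('a, 'a, 'v::quantale) vrel \<Rightarrow> bool" where
  "vcategory A \<alpha> \<longleftrightarrow> \<alpha> \<in> vrels A A \<and>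
     (\<forall>x\<in>A. 1 \<le> \<alpha> (x, x)) \<and> vle A A (vcomp A A A \<alpha> \<alpha>) \<alpha>"

definition vfunctor ::
  "'a set \<Rightarrow> ('a, 'a, 'v::quantale) vrel \<Rightarrow> ('c, 'c, 'v) vrel \<Rightarrow> ('a \<Rightarrow> 'c) \<Rightarrow> bool" where
  "vfunctor A \<alpha> \<gamma> f \<longleftrightarrow> (\<forall>x\<in>A. \<forall>y\<in>A. \<alpha> (x, y) \<le> \<gamma> (f x, f y))"


section \<open>The powerset and ultrafilter monads\<close>

definition ultrafilters :: "'a set \<Rightarrow> 'a set set set" where
  "ultrafilters A = {\<xx>. \<xx> \<subseteq> Pow A \<and> A \<in> \<xx> \<and> {} \<notin> \<xx> \<and>
     (\<forall>S\<in>\<xx>. \<forall>T\<in>\<xx>. S \<inter> T \<in> \<xx>) \<and>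
     (\<forall>S\<in>\<xx>. \<forall>T. S \<subseteq> T \<and> T \<subseteq> A \<longrightarrow> T \<in> \<xx>) \<and>
     (\<forall>S. S \<subseteq> A \<longrightarrow> S \<in> \<xx> \<or> A - S \<in> \<xx>)}"

definition ultra_map :: "'a set \<Rightarrow> 'c set \<Rightarrow> ('a \<Rightarrow> 'c) \<Rightarrow> 'a set set \<Rightarrow> 'c set set" where
  "ultra_map A C f \<xx> = {T. T \<subseteq> C \<and> f -` T \<inter> A \<in> \<xx>}"

definition ultra_unit :: "'a set \<Rightarrow> 'a \<Rightarrow> 'a set set" where
  "ultra_unit A x = {S. S \<subseteq> A \<and> x \<in> S}"

definition sharp :: "'a set \<Rightarrow> 'a set \<Rightarrow> 'a set set set" where
  "sharp A S = {\<xx> \<in> ultrafilters A. S \<in> \<xx>}"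

definition ultra_mult :: "'a set \<Rightarrow> 'a set set set set \<Rightarrow> 'a set set" where
  "ultra_mult A \<XX> = {S. S \<subseteq> A \<and> sharp A S \<in> \<XX>}"

definition pow_rel ::
  "'a set \<Rightarrow> 'b set \<Rightarrow> ('a, 'b, 'v::quantale) vrel \<Rightarrow> ('a set, 'b set, 'v) vrel" where
  "pow_rel A B J = (\<lambda>(S, T)\<in>Pow A \<times> Pow B. INF t\<in>T. SUP s\<in>S. J (s, t))"

definition ultra_rel ::
  "'a set \<Rightarrow> 'b set \<Rightarrow> ('a, 'b, 'v::quantale) vrel \<Rightarrow> ('a set set, 'b set set, 'v) vrel" where
  "ultra_rel A B J = (\<lambda>(\<xx>, \<yy>)\<in>ultrafilters A \<times> ultrafilters B.
     INF (S, T)\<in>\<xx> \<times> \<yy>. SUP (s, t)\<in>S \<times> T. J (s, t))"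


section \<open>Ultrafilter-based structures\<close>

type_synonym ('a, 'v) uv = "('a set set, 'a, 'v) vrel"
type_synonym ('a, 'v) uv_obj = "'a set \<times> ('a, 'v) uv"
type_synonym ('a, 'v) uv_mod_obj = "'a set \<times> ('a, 'a, 'v) vrel \<times> ('a, 'v) uv"

definition uv_graph :: "'a set \<Rightarrow> ('a, 'v::quantale) uv \<Rightarrow> bool" where
  "uv_graph A \<alpha> \<longleftrightarrow> \<alpha> \<in> vrels (ultrafilters A) A \<and>
     (\<forall>x\<in>A. 1 \<le> \<alpha> (ultra_unit A x, x)) \<and>
     (\<forall>\<XX>\<in>ultrafilters (ultrafilters A). \<forall>x\<in>A.
        ultra_rel (ultrafilters A) A \<alpha> (\<XX>, ultra_unit A x) \<le> \<alpha> (ultra_mult A \<XX>, x))"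

definition uv_category :: "'a set \<Rightarrow> ('a, 'v::quantale) uv \<Rightarrow> bool" where
  "uv_category A \<alpha> \<longleftrightarrow> \<alpha> \<in> vrels (ultrafilters A) A \<and>
     (\<forall>x\<in>A. 1 \<le> \<alpha> (ultra_unit A x, x)) \<and>
     (\<forall>\<XX>\<in>ultrafilters (ultrafilters A). \<forall>x\<in>A.
        vcomp (ultrafilters (ultrafilters A)) (ultrafilters A) A
          (ultra_rel (ultrafilters A) A \<alpha>) \<alpha> (\<XX>, x) \<le> \<alpha> (ultra_mult A \<XX>, x))"

definition uv_mor ::
  "('a, 'v::quantale) uv_obj \<Rightarrow> ('c, 'v) uv_obj \<Rightarrow> ('a \<Rightarrow> 'c) \<Rightarrow> bool" where
  "uv_mor = (\<lambda>(A, \<alpha>) (C, \<gamma>) f.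
     \<forall>\<xx>\<in>ultrafilters A. \<forall>x\<in>A. \<alpha> (\<xx>, x) \<le> \<gamma> (ultra_map A C f \<xx>, f x))"

definition UVUGph :: "(('a, 'v::quantale) uv_obj, 'a \<Rightarrow> 'a) precat" where
  "UVUGph = set_cat {(A, \<alpha>). uv_graph A \<alpha>} uv_mor"

definition UVCat :: "(('a, 'v::quantale) uv_obj, 'a \<Rightarrow> 'a) precat" where
  "UVCat = set_cat {(A, \<alpha>). uv_category A \<alpha>} uv_mor"

definition uv_modular ::
  "'a set \<Rightarrow> ('a, 'a, 'v::quantale) vrel \<Rightarrow> ('a, 'v) uv \<Rightarrow> bool" where
  "uv_modular A h \<alpha> \<longleftrightarrow> vle (ultrafilters A) A
     (vcomp (ultrafilters A) A A
        (vcomp (ultrafilters A) (ultrafilters A) A (ultra_rel A A h) \<alpha>) h) \<alpha>"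

definition uv_mod_mor ::
  "('a, 'v::quantale) uv_mod_obj
    \<Rightarrow> ('c, 'v) uv_mod_obj \<Rightarrow> ('a \<Rightarrow> 'c) \<Rightarrow> bool" where
  "uv_mod_mor = (\<lambda>(A, h, \<alpha>) (C, g, \<gamma>) f. vfunctor A h g f \<and> uv_mor (A, \<alpha>) (C, \<gamma>) f)"

definition UVModUGph ::
  "(('a, 'v::quantale) uv_mod_obj, 'a \<Rightarrow> 'a) precat" where
  "UVModUGph = set_cat
     {(A, h, \<alpha>). vcategory A h \<and> uv_graph A \<alpha> \<and> uv_modular A h \<alpha>} uv_mod_mor"

definition UVModCat ::
  "(('a, 'v::quantale) uv_mod_obj, 'a \<Rightarrow> 'a) precat" where
  "UVModCat = set_cat
     {(A, h, \<alpha>). vcategory A h \<and> uv_category A \<alpha> \<and> uv_modular A h \<alpha>} uv_mod_mor"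


section \<open>Closure structures\<close>

type_synonym ('a, 'v) cls = "('a set, 'a, 'v) vrel"
type_synonym ('a, 'v) cls_obj = "'a set \<times> ('a, 'v) cls"
type_synonym ('a, 'v) cls_mod_obj = "'a set \<times> ('a, 'a, 'v) vrel \<times> ('a, 'v) cls"

definition preclosure :: "'a set \<Rightarrow> ('a, 'v::quantale) cls \<Rightarrow> bool" where
  "preclosure A \<delta> \<longleftrightarrow> \<delta> \<in> vrels (Pow A) A \<and>
     (\<forall>x\<in>A. 1 \<le> \<delta> ({x}, x)) \<and>
     (\<forall>S T. S \<subseteq> T \<and> T \<subseteq> A \<longrightarrow> (\<forall>x\<in>A. \<delta> (S, x) \<le> \<delta> (T, x)))"

definition closure_space :: "'a set \<Rightarrow> ('a, 'v::quantale) cls \<Rightarrow> bool" where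
  "closure_space A \<delta> \<longleftrightarrow> \<delta> \<in> vrels (Pow A) A \<and>
     (\<forall>x\<in>A. 1 \<le> \<delta> ({x}, x)) \<and>
     (\<forall>\<Sigma>\<in>Pow (Pow A). \<forall>x\<in>A.
        vcomp (Pow (Pow A)) (Pow A) A (pow_rel (Pow A) A \<delta>) \<delta> (\<Sigma>, x) \<le> \<delta> (\<Union>\<Sigma>, x))"

definition cls_mor ::
  "('a, 'v::quantale) cls_obj \<Rightarrow> ('c, 'v) cls_obj \<Rightarrow> ('a \<Rightarrow> 'c) \<Rightarrow> bool" where
  "cls_mor = (\<lambda>(A, \<delta>) (C, \<zeta>) f. \<forall>S\<in>Pow A. \<forall>x\<in>A. \<delta> (S, x) \<le> \<zeta> (f ` S, f x))"

definition VPreCls :: "(('a, 'v::quantale) cls_obj, 'a \<Rightarrow> 'a) precat" where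
  "VPreCls = set_cat {(A, \<delta>). preclosure A \<delta>} cls_mor"

definition VCls :: "(('a, 'v::quantale) cls_obj, 'a \<Rightarrow> 'a) precat" where
  "VCls = set_cat {(A, \<delta>). closure_space A \<delta>} cls_mor"

definition cls_modular ::
  "'a set \<Rightarrow> ('a, 'a, 'v::quantale) vrel \<Rightarrow> ('a, 'v) cls \<Rightarrow> bool" where
  "cls_modular A h \<delta> \<longleftrightarrow> vle (Pow A) A
     (vcomp (Pow A) A A (vcomp (Pow A) (Pow A) A (pow_rel A A h) \<delta>) h) \<delta>"

definition cls_mod_mor ::
  "('a, 'v::quantale) cls_mod_obj
    \<Rightarrow> ('c, 'v) cls_mod_obj \<Rightarrow> ('a \<Rightarrow> 'c) \<Rightarrow> bool" where
  "cls_mod_mor = (\<lambda>(A, h, \<delta>) (C, g, \<zeta>) f. vfunctor A h g f \<and> cls_mor (A, \<delta>) (C, \<zeta>) f)"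

definition VModPreCls ::
  "(('a, 'v::quantale) cls_mod_obj, 'a \<Rightarrow> 'a) precat" where
  "VModPreCls = set_cat
     {(A, h, \<delta>). vcategory A h \<and> preclosure A \<delta> \<and> cls_modular A h \<delta>} cls_mod_mor"

definition VModCls ::
  "(('a, 'v::quantale) cls_mod_obj, 'a \<Rightarrow> 'a) precat" where
  "VModCls = set_cat
     {(A, h, \<delta>). vcategory A h \<and> closure_space A \<delta> \<and> cls_modular A h \<delta>} cls_mod_mor"

definition preserves_finite_joins :: "'a set \<Rightarrow> ('a, 'v::quantale) cls \<Rightarrow> bool" where
  "preserves_finite_joins A \<delta> \<longleftrightarrow> (\<forall>x\<in>A. \<delta> ({}, x) = bot \<and>
     (\<forall>S T. S \<subseteq> A \<and> T \<subseteq> A \<longrightarrow> \<delta> (S \<union> T, x) = sup (\<delta> (S, x)) (\<delta> (T, x))))"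

definition VModPreTop ::
  "(('a, 'v::quantale) cls_mod_obj, 'a \<Rightarrow> 'a) precat" where
  "VModPreTop = full_subcat VModPreCls (\<lambda>(A, h, \<delta>). preserves_finite_joins A \<delta>)"

definition VModTop ::
  "(('a, 'v::quantale) cls_mod_obj, 'a \<Rightarrow> 'a) precat" where
  "VModTop = full_subcat VModCls (\<lambda>(A, h, \<delta>). preserves_finite_joins A \<delta>)"


section \<open>The functors\<close>

text \<open>All functors below leave morphisms unchanged, so each of them is used between several pairs
  of categories. \<open>eps\<close> and \<open>Rfun\<close> are the functors written \<open>\<epsilon>\<close> with a tilde, and \<open>R\<close>; \<open>eps_bar\<close>
  and \<open>R_bar\<close> are their lifts.\<close>

definition eps_str :: "'a set \<Rightarrow> ('a, 'v::quantale) uv \<Rightarrow> ('a, 'v) cls" where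
  "eps_str A \<alpha> = (\<lambda>(S, x)\<in>Pow A \<times> A. SUP \<xx>\<in>{\<xx> \<in> ultrafilters A. S \<in> \<xx>}. \<alpha> (\<xx>, x))"

definition R_str :: "'a set \<Rightarrow> ('a, 'v::quantale) cls \<Rightarrow> ('a, 'v) uv" where
  "R_str A \<delta> = (\<lambda>(\<xx>, x)\<in>ultrafilters A \<times> A. INF S\<in>\<xx>. \<delta> (S, x))"

definition eps ::
  "(('a, 'v::quantale) uv_obj, 'a \<Rightarrow> 'a, ('a, 'v) cls_obj, 'a \<Rightarrow> 'a) ftor" where
  "eps = set_ftor (\<lambda>(A, \<alpha>). (A, eps_str A \<alpha>))"

definition Rfun ::
  "(('a, 'v::quantale) cls_obj, 'a \<Rightarrow> 'a, ('a, 'v) uv_obj, 'a \<Rightarrow> 'a) ftor" where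
  "Rfun = set_ftor (\<lambda>(A, \<delta>). (A, R_str A \<delta>))"

definition eps_bar ::
  "(('a, 'v::quantale) uv_mod_obj, 'a \<Rightarrow> 'a,
    ('a, 'v) cls_mod_obj, 'a \<Rightarrow> 'a) ftor" where
  "eps_bar = set_ftor (\<lambda>(A, h, \<alpha>). (A, h, eps_str A \<alpha>))"

definition R_bar ::
  "(('a, 'v::quantale) cls_mod_obj, 'a \<Rightarrow> 'a,
    ('a, 'v) uv_mod_obj, 'a \<Rightarrow> 'a) ftor" where
  "R_bar = set_ftor (\<lambda>(A, h, \<delta>). (A, h, R_str A \<delta>))"

definition forget_V ::
  "('a set \<times> ('a, 'a, 'v::quantale) vrel \<times> 's, 'a \<Rightarrow> 'a, 'a set \<times> 's, 'a \<Rightarrow> 'a) ftor" where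
  "forget_V = set_ftor (\<lambda>(A, h, s). (A, s))"

definition N_uv ::
  "(('a, 'v::quantale) uv_obj, 'a \<Rightarrow> 'a,
    ('a, 'v) uv_mod_obj, 'a \<Rightarrow> 'a) ftor" where
  "N_uv = set_ftor (\<lambda>(A, \<alpha>). (A, (\<lambda>(x, y)\<in>A \<times> A. \<alpha> (ultra_unit A x, y)), \<alpha>))"

definition N_cls ::
  "(('a, 'v::quantale) cls_obj, 'a \<Rightarrow> 'a,
    ('a, 'v) cls_mod_obj, 'a \<Rightarrow> 'a) ftor" where
  "N_cls = set_ftor (\<lambda>(A, \<delta>). (A, (\<lambda>(x, y)\<in>A \<times> A. \<delta> ({x}, y)), \<delta>))"

end

theory Submission
  imports Defs
begin

text \<open>All functors involved keep the underlying set and the maps, and both units and counits are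
  identity maps. So a functor is a passage between structures that respects the two notions of
  morphism, an adjunction between such functors is a pair of inequalities between structures, and
  the triangle identities and strict equalities of functors cost nothing. What has to be shown is
  how the passages \<open>\<alpha> \<mapsto> eps_str A \<alpha>\<close> and \<open>\<delta> \<mapsto> R_str A \<delta>\<close> treat the axioms.

  The reflexivity axioms are immediate. The transitivity axiom and the modularity axiom are
  both about composing a structure with a lifted relation, \<open>ultra_rel\<close> on the ultrafilter side and
  \<open>pow_rel\<close> on the closure side, and two comparisons of these liftings settle both axioms:
  for \<open>T \<in> \<yy>\<close>, \<open>pow_rel J (S, T)\<close> is at most the supremum of \<open>ultra_rel J (\<xx>, \<yy>)\<close> over
  ultrafilters \<open>\<xx>\<close> containing \<open>S\<close> (\<open>pow_rel_le_SUP_ultra_rel\<close>), which transports axioms along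
  \<open>eps_str\<close>; and for \<open>S \<in> \<xx>\<close>, \<open>ultra_rel J (\<xx>, \<yy>)\<close> is at most the supremum of
  \<open>pow_rel J (S, T)\<close> over \<open>T \<in> \<yy>\<close> (\<open>ultra_rel_le_SUP_pow_rel\<close>), which transports them along
  \<open>R_str\<close>. Complete distributivity enters through the totally-below relation \<open>u \<lless> v\<close>: every \<open>v\<close>
  is the supremum of the \<open>u \<lless> v\<close>, so an inequality can be tested on these \<open>u\<close>, and \<open>u \<lless> v\<close>
  turns a bound of \<open>v\<close> by a supremum into a single member of the supremum that is above \<open>u\<close>.

  The isomorphisms say that the unit is an equality for every unitary graph, and the counit
  for every preclosure structure preserving finite joins. Both equalities come from extending a
  filter to an ultrafilter (\<open>ultrafilter_extending\<close>). For the unit (\<open>R_str_eps_str\<close>) it lives on the set of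
  ultrafilters and is fed into the unitary graph axiom; for the counit (\<open>eps_str_R_str\<close>) it avoids
  the sets \<open>T\<close> for which \<open>u \<lless> \<delta> (T, x)\<close> fails, which form an ideal because
  \<open>\<delta>\<close> preserves finite joins. The structures \<open>eps_str A \<alpha>\<close> preserve finite joins because
  ultrafilters are prime.

  Finally, the underlying \<open>'v\<close>-category of a structure is its restriction to principal
  ultrafilters or singletons; it acts on the structure by the transitivity axiom, and it is the
  largest one doing so, which gives the adjunctions between forgetting and normalising.\<close>

section \<open>Quantales and the totally-below relation\<close>

lemma quantale_mult_mono:
  fixes a b c d :: "'v::quantale"
  assumes "a \<le> b" "c \<le> d"
  shows "a * c \<le> b * d"
proof -
  have "a * c \<le> b * c"
    using Sup_mult_distrib[of "{a, b}" c] assms(1) by (simp add: sup.absorb2 le_iff_sup)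
  also have "\<dots> \<le> b * d"
    using mult_Sup_distrib[of b "{c, d}"] assms(2) by (simp add: sup.absorb2 le_iff_sup)
  finally show ?thesis .
qed

definition totally_below :: "'v::complete_lattice \<Rightarrow> 'v \<Rightarrow> bool" (infix \<open>\<lless>\<close> 50) where
  "u \<lless> v \<longleftrightarrow> (\<forall>X. v \<le> Sup X \<longrightarrow> (\<exists>x\<in>X. u \<le> x))"

lemma totally_below_imp_le: "u \<lless> v \<Longrightarrow> u \<le> v"
  unfolding totally_below_def by (metis Sup_insert Sup_empty order_refl singletonD sup_bot_right)

lemma totally_below_SUP:
  "u \<lless> v \<Longrightarrow> v \<le> (SUP i\<in>I. f i) \<Longrightarrow> \<exists>i\<in>I. u \<le> f i"
  unfolding totally_below_def by blast

lemma totally_below_mono: "u \<lless> v \<Longrightarrow> v \<le> w \<Longrightarrow> u \<lless> w"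
  unfolding totally_below_def by (meson order_trans)

lemma not_totally_below_bot: "\<not> u \<lless> bot"
  unfolding totally_below_def by (metis bot_least empty_iff)

text \<open>A supremum of two elements is covered by the union of a cover of each, so being totally below
  is prime with respect to binary joins. This is what makes the sets used in
  \<open>eps_str_R_str\<close> an ideal.\<close>

lemma totally_below_sup:
  assumes "u \<lless> sup v w"
  shows "u \<lless> v \<or> u \<lless> w"
proof (rule ccontr)
  assume "\<not> ?thesis"
  then obtain X Y where X: "v \<le> Sup X" "\<not> (\<exists>x\<in>X. u \<le> x)"
    and Y: "w \<le> Sup Y" "\<not> (\<exists>y\<in>Y. u \<le> y)"
    unfolding totally_below_def by blast
  have "sup v w \<le> Sup (X \<union> Y)"
    using X(1) Y(1) by (simp add: Sup_union_distrib le_supI1 le_supI2)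
  with assms X(2) Y(2) show False
    unfolding totally_below_def by blast
qed

text \<open>The members of \<open>L v\<close>, for the left adjoint \<open>L\<close> of \<open>Sup\<close>, are totally below \<open>v\<close>: apply the
  adjunction to the downset generated by a cover of \<open>v\<close>. Applied to \<open>L v\<close> itself, the adjunction
  bounds \<open>v\<close> by the supremum of \<open>L v\<close>.\<close>

lemma le_if_totally_below_le:
  fixes v w :: "'v::complete_lattice"
  assumes "completely_distributive TYPE('v)" and below: "\<And>u. u \<lless> v \<Longrightarrow> u \<le> w"
  shows "v \<le> w"
proof -
  obtain L :: "'v \<Rightarrow> 'v set" where down: "\<And>v. is_downset (L v)"
    and adj: "\<And>v D. is_downset D \<Longrightarrow> L v \<subseteq> D \<longleftrightarrow> v \<le> Sup D"
    using assms(1) unfolding completely_distributive_def by blast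
  have "u \<lless> v" if "u \<in> L v" for u
    unfolding totally_below_def
  proof (intro allI impI)
    fix X assume "v \<le> Sup X"
    let ?D = "{y. \<exists>x\<in>X. y \<le> x}"
    have "is_downset ?D" unfolding is_downset_def by (auto intro: order_trans)
    moreover have "Sup X \<le> Sup ?D" by (rule Sup_subset_mono) auto
    ultimately have "L v \<subseteq> ?D" using adj \<open>v \<le> Sup X\<close> order_trans by blast
    with that show "\<exists>x\<in>X. u \<le> x" by blast
  qed
  then have "Sup (L v) \<le> w" by (auto intro: Sup_least below)
  moreover have "v \<le> Sup (L v)" using adj[OF down] by blast
  ultimately show ?thesis by (rule order_trans[rotated])
qed


section \<open>Ultrafilters\<close>

lemma ultrafilters_D:
  assumes "\<xx> \<in> ultrafilters A"
  shows ultrafilter_subset: "S \<in> \<xx> \<Longrightarrow> S \<subseteq> A"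
    and ultrafilter_carrier: "A \<in> \<xx>"
    and ultrafilter_empty: "{} \<notin> \<xx>"
    and ultrafilter_Int: "S \<in> \<xx> \<Longrightarrow> T \<in> \<xx> \<Longrightarrow> S \<inter> T \<in> \<xx>"
    and ultrafilter_up: "S \<in> \<xx> \<Longrightarrow> S \<subseteq> T \<Longrightarrow> T \<subseteq> A \<Longrightarrow> T \<in> \<xx>"
    and ultrafilter_Compl: "S \<subseteq> A \<Longrightarrow> S \<notin> \<xx> \<Longrightarrow> A - S \<in> \<xx>"
  using assms unfolding ultrafilters_def by blast+

lemma ultrafilter_Int_nonempty:
  "\<xx> \<in> ultrafilters A \<Longrightarrow> S \<in> \<xx> \<Longrightarrow> T \<in> \<xx> \<Longrightarrow> S \<inter> T \<noteq> {}"
  by (metis ultrafilter_Int ultrafilter_empty)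

lemma ultrafilter_Un_iff:
  assumes "\<xx> \<in> ultrafilters A" "S \<subseteq> A" "T \<subseteq> A"
  shows "S \<union> T \<in> \<xx> \<longleftrightarrow> S \<in> \<xx> \<or> T \<in> \<xx>"
proof
  assume un: "S \<union> T \<in> \<xx>"
  show "S \<in> \<xx> \<or> T \<in> \<xx>"
  proof (rule ccontr)
    assume "\<not> ?thesis"
    then have "A - S \<in> \<xx>" "A - T \<in> \<xx>" using assms ultrafilter_Compl by blast+
    then have "(A - S) \<inter> (A - T) \<in> \<xx>" using assms(1) ultrafilter_Int by blast
    from ultrafilter_Int_nonempty[OF assms(1) un this] show False by blast
  qed
next
  assume "S \<in> \<xx> \<or> T \<in> \<xx>"
  then show "S \<union> T \<in> \<xx>" using ultrafilter_up[OF assms(1)] assms(2,3)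
    by (metis Un_least sup_ge1 sup_ge2)
qed

lemma ultrafilter_maximal:
  assumes "\<xx> \<in> ultrafilters A" "\<yy> \<in> ultrafilters A" "\<xx> \<subseteq> \<yy>"
  shows "\<xx> = \<yy>"
proof (rule subset_antisym[OF assms(3)], rule subsetI, rule ccontr)
  fix S assume S: "S \<in> \<yy>" "S \<notin> \<xx>"
  then have "A - S \<in> \<yy>"
    using assms ultrafilter_Compl ultrafilter_subset by blast
  from ultrafilter_Int_nonempty[OF assms(2) S(1) this] show False by blast
qed

text \<open>Zorn's lemma yields a maximal \<open>M\<close> among the families of subsets of \<open>A\<close> that contain \<open>\<B>\<close>, are
  closed under intersection and omit the empty set. Both upward closure and primeness then follow
  from the fact that a maximal family contains every set meeting all of its members.\<close>

theorem ultrafilter_extending: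
  assumes sub: "\<B> \<subseteq> Pow A" and A: "A \<in> \<B>" and ne: "{} \<notin> \<B>"
    and Int: "\<And>S T. S \<in> \<B> \<Longrightarrow> T \<in> \<B> \<Longrightarrow> S \<inter> T \<in> \<B>"
  obtains \<xx> where "\<xx> \<in> ultrafilters A" "\<B> \<subseteq> \<xx>"
proof -
  define \<C> where "\<C> = {F. F \<subseteq> Pow A \<and> \<B> \<subseteq> F \<and> {} \<notin> F \<and> (\<forall>S\<in>F. \<forall>T\<in>F. S \<inter> T \<in> F)}"
  have "\<exists>M\<in>\<C>. \<forall>F\<in>\<C>. M \<subseteq> F \<longrightarrow> F = M"
  proof (rule subset_Zorn_nonempty)
    have "\<B> \<in> \<C>" using sub ne Int by (simp add: \<C>_def)
    then show "\<C> \<noteq> {}" by blast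
  next
    fix K assume "K \<noteq> {}" and K: "subset.chain \<C> K"
    have inC: "F \<subseteq> Pow A" "\<B> \<subseteq> F" "{} \<notin> F" "\<And>S T. S \<in> F \<Longrightarrow> T \<in> F \<Longrightarrow> S \<inter> T \<in> F"
      if "F \<in> K" for F
    proof -
      have "F \<in> \<C>" using that K unfolding subset_chain_def by blast
      then show "F \<subseteq> Pow A" "\<B> \<subseteq> F" "{} \<notin> F"
        "\<And>S T. S \<in> F \<Longrightarrow> T \<in> F \<Longrightarrow> S \<inter> T \<in> F"
        unfolding \<C>_def by simp_all
    qed
    have "S \<inter> T \<in> \<Union>K" if ST: "S \<in> \<Union>K" "T \<in> \<Union>K" for S T
    proof -
      obtain F G where FG: "F \<in> K" "S \<in> F" "G \<in> K" "T \<in> G" using ST by blast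
      then have "F \<subseteq> G \<or> G \<subseteq> F" using K unfolding subset_chain_def by blast
      then show ?thesis
      proof
        assume "F \<subseteq> G"
        then have "S \<inter> T \<in> G" using FG inC(4)[OF FG(3)] by blast
        then show ?thesis using FG(3) by blast
      next
        assume "G \<subseteq> F"
        then have "S \<inter> T \<in> F" using FG inC(4)[OF FG(1)] by blast
        then show ?thesis using FG(1) by blast
      qed
    qed
    moreover have "\<Union>K \<subseteq> Pow A" using inC(1) by blast
    moreover have "\<B> \<subseteq> \<Union>K" using inC(2) \<open>K \<noteq> {}\<close> by blast
    moreover have "{} \<notin> \<Union>K" using inC(3) by blast
    ultimately show "\<Union>K \<in> \<C>" unfolding \<C>_def by simp
  qed
  then obtain M where M: "M \<in> \<C>" and max: "\<And>F. F \<in> \<C> \<Longrightarrow> M \<subseteq> F \<Longrightarrow> F = M" by blast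
  have MP: "M \<subseteq> Pow A" "\<B> \<subseteq> M" "{} \<notin> M" "\<And>S T. S \<in> M \<Longrightarrow> T \<in> M \<Longrightarrow> S \<inter> T \<in> M"
    using M unfolding \<C>_def by simp_all
  \<comment> \<open>By maximality, \<open>M\<close> contains every set that meets all of its members.\<close>
  have meets: "S \<in> M" if S: "S \<subseteq> A" "\<And>X. X \<in> M \<Longrightarrow> X \<inter> S \<noteq> {}" for S
  proof -
    let ?F = "M \<union> (\<lambda>X. X \<inter> S) ` M"
    have "?F \<in> \<C>"
      unfolding \<C>_def
    proof (intro CollectI conjI ballI)
      show "?F \<subseteq> Pow A" "\<B> \<subseteq> ?F" "{} \<notin> ?F" using MP(1-3) S by blast+
    next
      fix P Q assume "P \<in> ?F" "Q \<in> ?F"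
      then obtain X Y where XY: "X \<in> M" "Y \<in> M"
        and "(P = X \<and> Q = Y) \<or> P \<inter> Q = (X \<inter> Y) \<inter> S" by blast
      moreover from XY have "X \<inter> Y \<in> M" by (rule MP(4))
      ultimately show "P \<inter> Q \<in> ?F" by (metis UnCI imageI)
    qed
    then have "?F = M" using max by blast
    moreover have "A \<inter> S \<in> ?F" using A MP(2) by blast
    ultimately show ?thesis using S(1) by (simp add: Int_absorb1)
  qed
  have "M \<in> ultrafilters A"
    unfolding ultrafilters_def
  proof (intro CollectI conjI allI ballI impI)
    show "M \<subseteq> Pow A" "A \<in> M" "{} \<notin> M" using MP A by blast+
    show "S \<inter> T \<in> M" if "S \<in> M" "T \<in> M" for S T using MP(4) that .
    show "T \<in> M" if ST: "S \<in> M" "S \<subseteq> T \<and> T \<subseteq> A" for S T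
    proof (rule meets)
      fix X assume "X \<in> M"
      then have "X \<inter> S \<in> M" using MP(4) ST by blast
      then have "X \<inter> S \<noteq> {}" using MP(3) by auto
      then show "X \<inter> T \<noteq> {}" using ST(2) by blast
    qed (simp add: ST)
    show "S \<in> M \<or> A - S \<in> M" if "S \<subseteq> A" for S
    proof (rule ccontr)
      assume neg: "\<not> ?thesis"
      have "\<exists>X\<in>M. X \<inter> S = {}" using neg meets[OF that] by auto
      moreover have "\<exists>Y\<in>M. Y \<inter> (A - S) = {}" using neg meets[of "A - S"] by auto
      ultimately obtain X Y where "X \<in> M" "X \<inter> S = {}" "Y \<in> M" "Y \<inter> (A - S) = {}" by auto
      moreover from this have "X \<inter> Y = {}" using MP(1) by blast
      moreover from calculation have "X \<inter> Y \<in> M" by (intro MP(4))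
      ultimately show False using MP(3) by simp
    qed
  qed
  then show ?thesis using that MP(2) by blast
qed

lemma ultra_unit_ultrafilter: "x \<in> A \<Longrightarrow> ultra_unit A x \<in> ultrafilters A"
  unfolding ultra_unit_def ultrafilters_def by auto

lemma ultrafilter_singleton:
  assumes "\<xx> \<in> ultrafilters A" "{x} \<in> \<xx>"
  shows "\<xx> = ultra_unit A x"
proof -
  have "x \<in> A" using assms ultrafilter_subset by blast
  have "ultra_unit A x \<subseteq> \<xx>"
    using ultrafilter_up[OF assms] unfolding ultra_unit_def by blast
  then show ?thesis
    using ultrafilter_maximal ultra_unit_ultrafilter \<open>x \<in> A\<close> assms(1) by metis
qed

lemma ultra_map_ultrafilter:
  assumes \<xx>: "\<xx> \<in> ultrafilters A" and f: "f ` A \<subseteq> C"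
  shows "ultra_map A C f \<xx> \<in> ultrafilters C"
  unfolding ultrafilters_def
proof (intro CollectI conjI allI ballI impI)
  show "ultra_map A C f \<xx> \<subseteq> Pow C" "{} \<notin> ultra_map A C f \<xx>"
    using ultrafilter_empty[OF \<xx>] unfolding ultra_map_def by auto
  have "f -` C \<inter> A = A" using f by blast
  then show "C \<in> ultra_map A C f \<xx>"
    using ultrafilter_carrier[OF \<xx>] unfolding ultra_map_def by simp
next
  fix S T assume "S \<in> ultra_map A C f \<xx>" "T \<in> ultra_map A C f \<xx>"
  then have "S \<inter> T \<subseteq> C" "(f -` S \<inter> A) \<inter> (f -` T \<inter> A) \<in> \<xx>"
    using ultrafilter_Int[OF \<xx>] unfolding ultra_map_def by blast+
  moreover have "(f -` S \<inter> A) \<inter> (f -` T \<inter> A) = f -` (S \<inter> T) \<inter> A" by blast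
  ultimately show "S \<inter> T \<in> ultra_map A C f \<xx>" unfolding ultra_map_def by simp
next
  fix S T assume "S \<in> ultra_map A C f \<xx>" "S \<subseteq> T \<and> T \<subseteq> C"
  moreover from this have "f -` S \<inter> A \<subseteq> f -` T \<inter> A" by blast
  ultimately show "T \<in> ultra_map A C f \<xx>"
    using ultrafilter_up[OF \<xx>] unfolding ultra_map_def by blast
next
  fix S assume "S \<subseteq> C"
  have "A - (f -` S \<inter> A) = f -` (C - S) \<inter> A" using f by blast
  then show "S \<in> ultra_map A C f \<xx> \<or> C - S \<in> ultra_map A C f \<xx>"
    using ultrafilter_Compl[OF \<xx>, of "f -` S \<inter> A"] \<open>S \<subseteq> C\<close> unfolding ultra_map_def by auto
qed

lemma ultra_map_idmap: "\<xx> \<in> ultrafilters A \<Longrightarrow> ultra_map A A (\<lambda>x\<in>A. x) \<xx> = \<xx>"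
proof -
  assume \<xx>: "\<xx> \<in> ultrafilters A"
  have "(\<lambda>x\<in>A. x) -` T \<inter> A = T" if "T \<subseteq> A" for T using that by auto
  then show ?thesis using ultrafilter_subset[OF \<xx>] unfolding ultra_map_def by fastforce
qed

lemma ultra_map_compose:
  assumes "f ` A \<subseteq> C"
  shows "ultra_map A D (compose A g f) \<xx> = ultra_map C D g (ultra_map A C f \<xx>)"
proof -
  have "compose A g f -` T \<inter> A = f -` (g -` T \<inter> C) \<inter> A" for T
    using assms by (auto simp: compose_def)
  then show ?thesis unfolding ultra_map_def by auto
qed

lemma ultra_map_ultra_unit:
  "x \<in> A \<Longrightarrow> f x \<in> C \<Longrightarrow> ultra_map A C f (ultra_unit A x) = ultra_unit C (f x)"
  unfolding ultra_map_def ultra_unit_def by auto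

lemma ultra_mult_ultrafilter:
  assumes \<XX>: "\<XX> \<in> ultrafilters (ultrafilters A)"
  shows "ultra_mult A \<XX> \<in> ultrafilters A"
proof -
  have sharp: "sharp A A = ultrafilters A" "sharp A {} = {}"
    "\<And>S. sharp A S \<subseteq> ultrafilters A"
    "\<And>S T. S \<subseteq> A \<Longrightarrow> T \<subseteq> A \<Longrightarrow> sharp A (S \<inter> T) = sharp A S \<inter> sharp A T"
    "\<And>S T. S \<subseteq> T \<Longrightarrow> T \<subseteq> A \<Longrightarrow> sharp A S \<subseteq> sharp A T"
    "\<And>S. S \<subseteq> A \<Longrightarrow> ultrafilters A - sharp A S \<subseteq> sharp A (A - S)"
    unfolding sharp_def
    by (auto simp: ultrafilter_carrier ultrafilter_empty ultrafilter_Compl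
        intro: ultrafilter_Int ultrafilter_up)
  show ?thesis
    unfolding ultrafilters_def
  proof (intro CollectI conjI allI ballI impI)
    show "ultra_mult A \<XX> \<subseteq> Pow A" "{} \<notin> ultra_mult A \<XX>" "A \<in> ultra_mult A \<XX>"
      using ultrafilter_empty[OF \<XX>] ultrafilter_carrier[OF \<XX>] sharp(1,2)
      unfolding ultra_mult_def by auto
    show "S \<inter> T \<in> ultra_mult A \<XX>" if "S \<in> ultra_mult A \<XX>" "T \<in> ultra_mult A \<XX>" for S T
      using that sharp(4) ultrafilter_Int[OF \<XX>] unfolding ultra_mult_def by auto
    show "T \<in> ultra_mult A \<XX>" if "S \<in> ultra_mult A \<XX>" "S \<subseteq> T \<and> T \<subseteq> A" for S T
      using that sharp(5)[of S T] ultrafilter_up[OF \<XX> _ _ sharp(3), of "sharp A S" T]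
      unfolding ultra_mult_def by simp
    show "S \<in> ultra_mult A \<XX> \<or> A - S \<in> ultra_mult A \<XX>" if "S \<subseteq> A" for S
      using that ultrafilter_Compl[OF \<XX> sharp(3)[of S]]
        ultrafilter_up[OF \<XX> _ sharp(6)[OF that] sharp(3)]
      unfolding ultra_mult_def by auto
  qed
qed

lemma ultra_mult_ultra_unit:
  "\<xx> \<in> ultrafilters A \<Longrightarrow> ultra_mult A (ultra_unit (ultrafilters A) \<xx>) = \<xx>"
  unfolding ultra_mult_def ultra_unit_def sharp_def by (auto dest: ultrafilter_subset)

lemma ultra_mult_ultra_map_ultra_unit:
  assumes "\<xx> \<in> ultrafilters A"
  shows "ultra_mult A (ultra_map A (ultrafilters A) (ultra_unit A) \<xx>) = \<xx>"
proof -
  have "ultra_unit A -` sharp A S \<inter> A = S" if "S \<subseteq> A" for S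
    using that unfolding sharp_def
    by (auto simp: ultra_unit_ultrafilter) (auto simp: ultra_unit_def)
  then show ?thesis
    using ultrafilter_subset[OF assms] unfolding ultra_mult_def ultra_map_def
    by (auto simp: sharp_def)
qed


section \<open>Comparing the two extensions of a relation\<close>

lemma vcomp_apply:
  "x \<in> A \<Longrightarrow> z \<in> E \<Longrightarrow> vcomp A B E J H (x, z) = (SUP y\<in>B. J (x, y) * H (y, z))"
  unfolding vcomp_def by simp

lemma pow_rel_apply:
  "S \<subseteq> A \<Longrightarrow> T \<subseteq> B \<Longrightarrow> pow_rel A B J (S, T) = (INF t\<in>T. SUP s\<in>S. J (s, t))"
  unfolding pow_rel_def by simp

lemma ultra_rel_le:
  "\<xx> \<in> ultrafilters A \<Longrightarrow> \<yy> \<in> ultrafilters B \<Longrightarrow> S \<in> \<xx> \<Longrightarrow> T \<in> \<yy> \<Longrightarrow>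
    ultra_rel A B J (\<xx>, \<yy>) \<le> (SUP (s, t)\<in>S \<times> T. J (s, t))"
  unfolding ultra_rel_def by (auto intro: INF_lower2[of "(S, T)"])

lemma le_ultra_rel:
  assumes "\<xx> \<in> ultrafilters A" "\<yy> \<in> ultrafilters B"
    and "\<And>S T. S \<in> \<xx> \<Longrightarrow> T \<in> \<yy> \<Longrightarrow> \<exists>s\<in>S. \<exists>t\<in>T. u \<le> J (s, t)"
  shows "u \<le> ultra_rel A B J (\<xx>, \<yy>)"
proof -
  have "u \<le> (SUP (s, t)\<in>S \<times> T. J (s, t))" if ST: "S \<in> \<xx>" "T \<in> \<yy>" for S T
  proof -
    obtain s t where "s \<in> S" "t \<in> T" "u \<le> J (s, t)" using assms(3)[OF ST] by blast
    then show ?thesis by (auto intro: SUP_upper2[of "(s, t)"])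
  qed
  then show ?thesis using assms(1,2) unfolding ultra_rel_def by (auto intro!: INF_greatest)
qed

text \<open>If \<open>u\<close> is totally below the left-hand side, every \<open>t \<in> T\<close> has some \<open>g t \<in> S\<close> with
  \<open>u \<le> J (g t, t)\<close>. The image of \<open>\<yy>\<close> under \<open>g\<close> is an ultrafilter \<open>\<xx>\<close> containing \<open>S\<close>, and any
  members of \<open>\<xx>\<close> and \<open>\<yy>\<close> contain a pair \<open>g t\<close>, \<open>t\<close>.\<close>

lemma pow_rel_le_SUP_ultra_rel:
  fixes J :: "('x, 'b, 'v::quantale) vrel"
  assumes cd: "completely_distributive TYPE('v)"
    and S: "S \<subseteq> X" and \<yy>: "\<yy> \<in> ultrafilters B" and T: "T \<in> \<yy>"
  shows "pow_rel X B J (S, T) \<le> (SUP \<xx>\<in>sharp X S. ultra_rel X B J (\<xx>, \<yy>))"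
proof (rule le_if_totally_below_le[OF cd])
  fix u assume u: "u \<lless> pow_rel X B J (S, T)"
  have TB: "T \<subseteq> B" using ultrafilter_subset[OF \<yy> T] .
  have "\<exists>s\<in>S. u \<le> J (s, t)" if "t \<in> T" for t
    by (rule totally_below_SUP[OF u])
      (use that S TB in \<open>auto simp: pow_rel_apply intro: INF_lower\<close>)
  then obtain g where g: "\<And>t. t \<in> T \<Longrightarrow> g t \<in> S \<and> u \<le> J (g t, t)" by metis
  obtain t0 where t0: "t0 \<in> T"
    using ultrafilter_empty[OF \<yy>] T by (metis ex_in_conv)
  \<comment> \<open>Outside \<open>T\<close> the choice function takes an arbitrary value in \<open>S\<close>;
    since \<open>T\<close> is a member of \<open>\<yy>\<close>, this does not affect the image ultrafilter.\<close>
  define h where "h t = (if t \<in> T then g t else g t0)" for t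
  have hS: "h t \<in> S" for t using g t0 unfolding h_def by simp
  define \<xx> where "\<xx> = ultra_map B X h \<yy>"
  have \<xx>: "\<xx> \<in> ultrafilters X"
    unfolding \<xx>_def using hS S by (intro ultra_map_ultrafilter[OF \<yy>]) blast
  have "h -` S \<inter> B = B" using hS by blast
  then have "S \<in> \<xx>" unfolding \<xx>_def ultra_map_def using S ultrafilter_carrier[OF \<yy>] by simp
  moreover have "u \<le> ultra_rel X B J (\<xx>, \<yy>)"
  proof (rule le_ultra_rel[OF \<xx> \<yy>])
    fix P Q assume "P \<in> \<xx>" "Q \<in> \<yy>"
    then have "h -` P \<inter> B \<in> \<yy>" "T \<inter> Q \<in> \<yy>"
      using T ultrafilter_Int[OF \<yy>] unfolding \<xx>_def ultra_map_def by auto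
    from ultrafilter_Int_nonempty[OF \<yy> this] obtain t
      where "h t \<in> P" "t \<in> T" "t \<in> Q" by blast
    then show "\<exists>s\<in>P. \<exists>t\<in>Q. u \<le> J (s, t)" using g unfolding h_def by auto
  qed
  ultimately show "u \<le> (SUP \<xx>\<in>sharp X S. ultra_rel X B J (\<xx>, \<yy>))"
    using \<xx> unfolding sharp_def by (auto intro: SUP_upper2)
qed

text \<open>For \<open>u\<close> totally below the left-hand side, the set \<open>T\<close> of all points that \<open>S\<close> reaches to degree
  at least \<open>u\<close> works. It belongs to \<open>\<yy>\<close>: if its complement did, the left-hand side would be bounded
  by a supremum over \<open>S\<close> and that complement, one member of which would be above \<open>u\<close>.\<close>

lemma ultra_rel_le_SUP_pow_rel:
  fixes J :: "('x, 'b, 'v::quantale) vrel"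
  assumes cd: "completely_distributive TYPE('v)"
    and \<xx>: "\<xx> \<in> ultrafilters X" and \<yy>: "\<yy> \<in> ultrafilters B" and S: "S \<in> \<xx>"
  shows "ultra_rel X B J (\<xx>, \<yy>) \<le> (SUP T\<in>\<yy>. pow_rel X B J (S, T))"
proof (rule le_if_totally_below_le[OF cd])
  fix u assume u: "u \<lless> ultra_rel X B J (\<xx>, \<yy>)"
  define T where "T = {t\<in>B. u \<le> (SUP s\<in>S. J (s, t))}"
  have "T \<in> \<yy>"
  proof (rule ccontr)
    assume "T \<notin> \<yy>"
    moreover have "T \<subseteq> B" unfolding T_def by auto
    ultimately have "B - T \<in> \<yy>" using ultrafilter_Compl[OF \<yy>] by simp
    with \<xx> \<yy> S have "ultra_rel X B J (\<xx>, \<yy>) \<le> (SUP (s, t)\<in>S \<times> (B - T). J (s, t))"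
      by (rule ultra_rel_le)
    then obtain s t where "s \<in> S" "t \<in> B - T" "u \<le> J (s, t)"
      using totally_below_SUP[OF u] by fastforce
    then have "u \<le> (SUP s\<in>S. J (s, t))" by (auto intro: SUP_upper2)
    then show False using \<open>t \<in> B - T\<close> unfolding T_def by simp
  qed
  moreover have "u \<le> pow_rel X B J (S, T)"
    using ultrafilter_subset[OF \<xx> S] by (simp add: pow_rel_apply T_def le_INF_iff)
  ultimately show "u \<le> (SUP T\<in>\<yy>. pow_rel X B J (S, T))" by (auto intro: SUP_upper2)
qed


section \<open>Structures on a set\<close>

lemma uv_graphD:
  assumes "uv_graph A \<alpha>"
  shows "\<alpha> \<in> vrels (ultrafilters A) A"
    and "x \<in> A \<Longrightarrow> 1 \<le> \<alpha> (ultra_unit A x, x)"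
    and "\<XX> \<in> ultrafilters (ultrafilters A) \<Longrightarrow> x \<in> A \<Longrightarrow>
      ultra_rel (ultrafilters A) A \<alpha> (\<XX>, ultra_unit A x) \<le> \<alpha> (ultra_mult A \<XX>, x)"
  using assms unfolding uv_graph_def by blast+

lemma uv_category_iff:
  "uv_category A \<alpha> \<longleftrightarrow> \<alpha> \<in> vrels (ultrafilters A) A \<and>
     (\<forall>x\<in>A. 1 \<le> \<alpha> (ultra_unit A x, x)) \<and>
     (\<forall>\<XX>\<in>ultrafilters (ultrafilters A). \<forall>\<yy>\<in>ultrafilters A. \<forall>x\<in>A.
        ultra_rel (ultrafilters A) A \<alpha> (\<XX>, \<yy>) * \<alpha> (\<yy>, x) \<le> \<alpha> (ultra_mult A \<XX>, x))"
  unfolding uv_category_def by (auto simp: vcomp_apply SUP_le_iff)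

lemma uv_categoryD:
  assumes "uv_category A \<alpha>"
  shows "\<alpha> \<in> vrels (ultrafilters A) A"
    and "x \<in> A \<Longrightarrow> 1 \<le> \<alpha> (ultra_unit A x, x)"
    and "\<XX> \<in> ultrafilters (ultrafilters A) \<Longrightarrow> \<yy> \<in> ultrafilters A \<Longrightarrow> x \<in> A \<Longrightarrow>
      ultra_rel (ultrafilters A) A \<alpha> (\<XX>, \<yy>) * \<alpha> (\<yy>, x) \<le> \<alpha> (ultra_mult A \<XX>, x)"
  using assms unfolding uv_category_iff by blast+

text \<open>The unitary graph axiom is the instance of transitivity at a principal ultrafilter, whose
  factor \<open>\<alpha> (ultra_unit A x, x)\<close> is above the unit.\<close>

lemma uv_category_imp_uv_graph:
  assumes "uv_category A \<alpha>"
  shows "uv_graph A \<alpha>"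
  unfolding uv_graph_def
proof (intro conjI ballI)
  fix \<XX> x assume \<XX>: "\<XX> \<in> ultrafilters (ultrafilters A)" and x: "x \<in> A"
  let ?u = "ultra_rel (ultrafilters A) A \<alpha> (\<XX>, ultra_unit A x)"
  have "?u = ?u * 1" by simp
  also have "\<dots> \<le> ?u * \<alpha> (ultra_unit A x, x)"
    using uv_categoryD(2)[OF assms x] by (intro quantale_mult_mono) auto
  also have "\<dots> \<le> \<alpha> (ultra_mult A \<XX>, x)"
    using uv_categoryD(3)[OF assms \<XX> ultra_unit_ultrafilter[OF x] x] .
  finally show "?u \<le> \<alpha> (ultra_mult A \<XX>, x)" .
qed (use uv_categoryD[OF assms] in auto)

lemma closure_space_iff:
  "closure_space A \<delta> \<longleftrightarrow> \<delta> \<in> vrels (Pow A) A \<and>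
     (\<forall>x\<in>A. 1 \<le> \<delta> ({x}, x)) \<and>
     (\<forall>\<Sigma>\<subseteq>Pow A. \<forall>T\<subseteq>A. \<forall>x\<in>A.
        (INF t\<in>T. SUP S\<in>\<Sigma>. \<delta> (S, t)) * \<delta> (T, x) \<le> \<delta> (\<Union>\<Sigma>, x))"
  unfolding closure_space_def by (auto simp: vcomp_apply pow_rel_apply SUP_le_iff)

lemma closure_spaceD:
  assumes "closure_space A \<delta>"
  shows "\<delta> \<in> vrels (Pow A) A"
    and "x \<in> A \<Longrightarrow> 1 \<le> \<delta> ({x}, x)"
    and "\<Sigma> \<subseteq> Pow A \<Longrightarrow> T \<subseteq> A \<Longrightarrow> x \<in> A \<Longrightarrow>
      (INF t\<in>T. SUP S\<in>\<Sigma>. \<delta> (S, t)) * \<delta> (T, x) \<le> \<delta> (\<Union>\<Sigma>, x)"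
  using assms unfolding closure_space_iff by blast+

lemma preclosureD:
  assumes "preclosure A \<delta>"
  shows "\<delta> \<in> vrels (Pow A) A"
    and "x \<in> A \<Longrightarrow> 1 \<le> \<delta> ({x}, x)"
    and "S \<subseteq> T \<Longrightarrow> T \<subseteq> A \<Longrightarrow> x \<in> A \<Longrightarrow> \<delta> (S, x) \<le> \<delta> (T, x)"
  using assms unfolding preclosure_def by blast+

text \<open>Monotonicity is the closure axiom for the family of singletons of the larger set, each
  of whose points lies in the closure of its own singleton.\<close>

lemma closure_space_imp_preclosure:
  assumes "closure_space A \<delta>"
  shows "preclosure A \<delta>"
  unfolding preclosure_def
proof (intro conjI ballI allI impI)
  fix S T x assume ST: "S \<subseteq> T \<and> T \<subseteq> A" and x: "x \<in> A"
  let ?\<Sigma> = "(\<lambda>t. {t}) ` T"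
  have "1 \<le> (INF s\<in>S. SUP P\<in>?\<Sigma>. \<delta> (P, s))"
  proof (rule INF_greatest)
    fix s assume "s \<in> S"
    then show "1 \<le> (SUP P\<in>?\<Sigma>. \<delta> (P, s))"
      using ST closure_spaceD(2)[OF assms] by (intro SUP_upper2[of "{s}"]) auto
  qed
  then have "1 * \<delta> (S, x) \<le> (INF s\<in>S. SUP P\<in>?\<Sigma>. \<delta> (P, s)) * \<delta> (S, x)"
    by (rule quantale_mult_mono) simp
  also have "\<dots> \<le> \<delta> (\<Union>?\<Sigma>, x)"
    using ST x by (intro closure_spaceD(3)[OF assms]) auto
  finally show "\<delta> (S, x) \<le> \<delta> (T, x)" by simp
qed (use closure_spaceD[OF assms] in auto)

lemma vcategory_iff:
  "vcategory A h \<longleftrightarrow> h \<in> vrels A A \<and> (\<forall>x\<in>A. 1 \<le> h (x, x)) \<and>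
     (\<forall>x\<in>A. \<forall>y\<in>A. \<forall>z\<in>A. h (x, y) * h (y, z) \<le> h (x, z))"
  unfolding vcategory_def vle_def by (auto simp: vcomp_apply SUP_le_iff)

lemma vle_vcomp_vcomp_iff:
  "vle A E (vcomp A C E (vcomp A B C J H) K) L \<longleftrightarrow>
    (\<forall>x\<in>A. \<forall>y\<in>B. \<forall>z\<in>C. \<forall>w\<in>E. J (x, y) * H (y, z) * K (z, w) \<le> L (x, w))"
  unfolding vle_def
  by (auto simp: vcomp_apply Sup_mult_distrib image_image SUP_le_iff)

lemma uv_modular_iff:
  "uv_modular A h \<alpha> \<longleftrightarrow> (\<forall>\<xx>\<in>ultrafilters A. \<forall>\<yy>\<in>ultrafilters A. \<forall>x\<in>A. \<forall>y\<in>A.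
    ultra_rel A A h (\<xx>, \<yy>) * \<alpha> (\<yy>, x) * h (x, y) \<le> \<alpha> (\<xx>, y))"
  unfolding uv_modular_def vle_vcomp_vcomp_iff ..

lemma cls_modular_iff:
  "cls_modular A h \<delta> \<longleftrightarrow> (\<forall>S\<subseteq>A. \<forall>T\<subseteq>A. \<forall>x\<in>A. \<forall>y\<in>A.
    pow_rel A A h (S, T) * \<delta> (T, x) * h (x, y) \<le> \<delta> (S, y))"
  unfolding cls_modular_def vle_vcomp_vcomp_iff by auto


section \<open>From ultrafilter structures to closure structures\<close>

lemma eps_str_apply:
  "S \<subseteq> A \<Longrightarrow> x \<in> A \<Longrightarrow> eps_str A \<alpha> (S, x) = (SUP \<xx>\<in>sharp A S. \<alpha> (\<xx>, x))"
  unfolding eps_str_def sharp_def by simp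

lemma le_eps_str:
  "\<xx> \<in> ultrafilters A \<Longrightarrow> S \<in> \<xx> \<Longrightarrow> x \<in> A \<Longrightarrow> \<alpha> (\<xx>, x) \<le> eps_str A \<alpha> (S, x)"
  by (subst eps_str_apply) (auto simp: sharp_def dest: ultrafilter_subset intro: SUP_upper)

lemma eps_str_vrels: "eps_str A \<alpha> \<in> vrels (Pow A) A"
  unfolding eps_str_def vrels_def by simp

lemma eps_str_singleton:
  assumes "x \<in> A" "y \<in> A"
  shows "eps_str A \<alpha> ({x}, y) = \<alpha> (ultra_unit A x, y)"
proof -
  have "{x} \<in> ultra_unit A x" using assms(1) unfolding ultra_unit_def by simp
  then have "sharp A {x} = {ultra_unit A x}"
    using ultra_unit_ultrafilter[OF assms(1)] unfolding sharp_def
    by (auto dest: ultrafilter_singleton)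
  then show ?thesis using assms by (simp add: eps_str_apply)
qed

lemma eps_str_mono:
  assumes "S \<subseteq> T" "T \<subseteq> A" "x \<in> A"
  shows "eps_str A \<alpha> (S, x) \<le> eps_str A \<alpha> (T, x)"
proof -
  have "sharp A S \<subseteq> sharp A T" using assms unfolding sharp_def by (auto intro: ultrafilter_up)
  then show ?thesis using assms by (auto simp: eps_str_apply intro: SUP_subset_mono)
qed

lemma preclosure_eps_str:
  "uv_graph A \<alpha> \<Longrightarrow> preclosure A (eps_str A \<alpha>)"
  unfolding preclosure_def
  by (auto simp: eps_str_vrels eps_str_singleton uv_graphD intro: eps_str_mono)

text \<open>No ultrafilter contains the empty set, and an ultrafilter containing a union contains one of
  the two parts.\<close>

lemma eps_str_preserves_finite_joins: "preserves_finite_joins A (eps_str A \<alpha>)"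
  unfolding preserves_finite_joins_def
proof (intro ballI conjI allI impI)
  fix x assume x: "x \<in> A"
  have "sharp A {} = {}" unfolding sharp_def by (auto dest: ultrafilter_empty)
  then show "eps_str A \<alpha> ({}, x) = bot" using x by (simp add: eps_str_apply)
  fix S T assume ST: "S \<subseteq> A \<and> T \<subseteq> A"
  then have "sharp A (S \<union> T) = sharp A S \<union> sharp A T"
    unfolding sharp_def by (auto simp: ultrafilter_Un_iff)
  then show "eps_str A \<alpha> (S \<union> T, x) = sup (eps_str A \<alpha> (S, x)) (eps_str A \<alpha> (T, x))"
    using ST x by (simp add: eps_str_apply SUP_union)
qed

text \<open>Since \<open>eps_str A \<alpha>\<close> is monotone, a family \<open>\<Sigma>\<close> can be replaced by its union \<open>B\<close>, and the degree
  to which \<open>B\<close> covers \<open>T\<close> is the \<open>pow_rel\<close>-degree to which \<open>sharp A B\<close> does under \<open>\<alpha>\<close>. For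
  each ultrafilter \<open>\<yy>\<close> containing \<open>T\<close> this is bounded through ultrafilters \<open>\<XX>\<close> containing
  \<open>sharp A B\<close>; the transitivity of \<open>\<alpha>\<close> applies to them, and the multiplication sends them to
  ultrafilters containing \<open>B\<close>.\<close>

lemma closure_space_eps_str:
  fixes \<alpha> :: "('a, 'v::quantale) uv"
  assumes cd: "completely_distributive TYPE('v)" and cat: "uv_category A \<alpha>"
  shows "closure_space A (eps_str A \<alpha>)"
  unfolding closure_space_iff
proof (intro conjI ballI allI impI)
  show "eps_str A \<alpha> \<in> vrels (Pow A) A" by (rule eps_str_vrels)
  show "1 \<le> eps_str A \<alpha> ({x}, x)" if "x \<in> A" for x
    using uv_categoryD(2)[OF cat] that by (simp add: eps_str_singleton)
  fix \<Sigma> T x assume \<Sigma>: "\<Sigma> \<subseteq> Pow A" and T: "T \<subseteq> A" and x: "x \<in> A"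
  let ?U = "ultrafilters A" and ?B = "\<Union>\<Sigma>"
  let ?a = "INF t\<in>T. SUP S\<in>\<Sigma>. eps_str A \<alpha> (S, t)"
  have B: "?B \<subseteq> A" "sharp A ?B \<subseteq> ?U" using \<Sigma> by (auto simp: sharp_def)
  have "?a \<le> (INF t\<in>T. eps_str A \<alpha> (?B, t))"
  proof (rule INF_superset_mono[OF order_refl])
    show "(SUP S\<in>\<Sigma>. eps_str A \<alpha> (S, t)) \<le> eps_str A \<alpha> (?B, t)" if "t \<in> T" for t
      using that T B by (intro SUP_least eps_str_mono) auto
  qed
  also have "\<dots> = pow_rel ?U A \<alpha> (sharp A ?B, T)"
    using B T by (subst pow_rel_apply) (auto simp: eps_str_apply subset_iff intro!: INF_cong)
  finally have a: "?a \<le> pow_rel ?U A \<alpha> (sharp A ?B, T)" .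
  have "?a * \<alpha> (\<yy>, x) \<le> eps_str A \<alpha> (?B, x)" if "\<yy> \<in> sharp A T" for \<yy>
  proof -
    have \<yy>: "\<yy> \<in> ?U" "T \<in> \<yy>" using that unfolding sharp_def by auto
    have "?a \<le> (SUP \<XX>\<in>sharp ?U (sharp A ?B). ultra_rel ?U A \<alpha> (\<XX>, \<yy>))"
      using a pow_rel_le_SUP_ultra_rel[OF cd B(2) \<yy>] by (rule order_trans)
    then have "?a * \<alpha> (\<yy>, x)
        \<le> (SUP \<XX>\<in>sharp ?U (sharp A ?B). ultra_rel ?U A \<alpha> (\<XX>, \<yy>)) * \<alpha> (\<yy>, x)"
      by (rule quantale_mult_mono) simp
    also have "\<dots> = (SUP \<XX>\<in>sharp ?U (sharp A ?B). ultra_rel ?U A \<alpha> (\<XX>, \<yy>) * \<alpha> (\<yy>, x))"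
      by (simp add: Sup_mult_distrib image_image)
    also have "\<dots> \<le> eps_str A \<alpha> (?B, x)"
    proof (rule SUP_least)
      fix \<XX> assume "\<XX> \<in> sharp ?U (sharp A ?B)"
      then have \<XX>: "\<XX> \<in> ultrafilters ?U" "?B \<in> ultra_mult A \<XX>"
        using B unfolding sharp_def[of ?U] ultra_mult_def by auto
      have "ultra_rel ?U A \<alpha> (\<XX>, \<yy>) * \<alpha> (\<yy>, x) \<le> \<alpha> (ultra_mult A \<XX>, x)"
        by (rule uv_categoryD(3)[OF cat \<XX>(1) \<yy>(1) x])
      also have "\<dots> \<le> eps_str A \<alpha> (?B, x)"
        by (rule le_eps_str[OF ultra_mult_ultrafilter[OF \<XX>(1)] \<XX>(2) x])
      finally show "ultra_rel ?U A \<alpha> (\<XX>, \<yy>) * \<alpha> (\<yy>, x) \<le> eps_str A \<alpha> (?B, x)" .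
    qed
    finally show ?thesis .
  qed
  then show "?a * eps_str A \<alpha> (T, x) \<le> eps_str A \<alpha> (?B, x)"
    using T x by (simp add: eps_str_apply[of T] mult_Sup_distrib image_image SUP_le_iff)
qed

text \<open>The same comparison as for transitivity, now applied to the relation \<open>h\<close> in place of \<open>\<alpha>\<close>.\<close>

lemma cls_modular_eps_str:
  fixes \<alpha> :: "('a, 'v::quantale) uv"
  assumes cd: "completely_distributive TYPE('v)" and mod: "uv_modular A h \<alpha>"
  shows "cls_modular A h (eps_str A \<alpha>)"
  unfolding cls_modular_iff
proof (intro ballI allI impI)
  fix S T x y assume S: "S \<subseteq> A" and T: "T \<subseteq> A" and x: "x \<in> A" and y: "y \<in> A"
  have "pow_rel A A h (S, T) * \<alpha> (\<yy>, x) * h (x, y) \<le> eps_str A \<alpha> (S, y)"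
    if "\<yy> \<in> sharp A T" for \<yy>
  proof -
    have \<yy>: "\<yy> \<in> ultrafilters A" "T \<in> \<yy>" using that unfolding sharp_def by auto
    have "pow_rel A A h (S, T) * \<alpha> (\<yy>, x) * h (x, y)
        \<le> (SUP \<xx>\<in>sharp A S. ultra_rel A A h (\<xx>, \<yy>)) * \<alpha> (\<yy>, x) * h (x, y)"
      by (intro quantale_mult_mono pow_rel_le_SUP_ultra_rel[OF cd S \<yy>]) auto
    also have "\<dots> = (SUP \<xx>\<in>sharp A S. ultra_rel A A h (\<xx>, \<yy>) * \<alpha> (\<yy>, x) * h (x, y))"
      by (simp add: Sup_mult_distrib image_image)
    also have "\<dots> \<le> (SUP \<xx>\<in>sharp A S. \<alpha> (\<xx>, y))"
      using mod \<yy> x y unfolding uv_modular_iff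
      by (intro SUP_subset_mono) (auto simp: sharp_def)
    finally show ?thesis using S y by (simp add: eps_str_apply)
  qed
  then show "pow_rel A A h (S, T) * eps_str A \<alpha> (T, x) * h (x, y) \<le> eps_str A \<alpha> (S, y)"
    using T x by (simp add: eps_str_apply[of T] mult_Sup_distrib Sup_mult_distrib image_image SUP_le_iff)
qed


section \<open>From closure structures to ultrafilter structures\<close>

lemma R_str_apply:
  "\<xx> \<in> ultrafilters A \<Longrightarrow> x \<in> A \<Longrightarrow> R_str A \<delta> (\<xx>, x) = (INF S\<in>\<xx>. \<delta> (S, x))"
  unfolding R_str_def by simp

lemma R_str_le:
  "\<xx> \<in> ultrafilters A \<Longrightarrow> x \<in> A \<Longrightarrow> S \<in> \<xx> \<Longrightarrow> R_str A \<delta> (\<xx>, x) \<le> \<delta> (S, x)"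
  unfolding R_str_apply by (rule INF_lower)

lemma R_str_vrels: "R_str A \<delta> \<in> vrels (ultrafilters A) A"
  unfolding R_str_def vrels_def by simp

lemma R_str_ultra_unit:
  assumes "preclosure A \<delta>" "x \<in> A"
  shows "1 \<le> R_str A \<delta> (ultra_unit A x, x)"
proof -
  have "1 \<le> \<delta> (S, x)" if "S \<in> ultra_unit A x" for S
  proof -
    have "1 \<le> \<delta> ({x}, x)" by (rule preclosureD(2)[OF assms])
    also have "\<dots> \<le> \<delta> (S, x)"
      using that assms(2) by (intro preclosureD(3)[OF assms(1)]) (auto simp: ultra_unit_def)
    finally show ?thesis .
  qed
  then show ?thesis
    using assms(2) by (simp add: R_str_apply ultra_unit_ultrafilter INF_greatest)
qed

text \<open>If \<open>S\<close> belongs to \<open>ultra_mult A \<XX>\<close>, then \<open>sharp A S\<close> belongs to \<open>\<XX>\<close>, and \<open>R_str A \<delta>\<close> is at most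
  \<open>\<delta> (S, x)\<close> on all of \<open>sharp A S\<close>.\<close>

lemma uv_graph_R_str:
  assumes "preclosure A \<delta>"
  shows "uv_graph A (R_str A \<delta>)"
  unfolding uv_graph_def
proof (intro conjI ballI)
  show "R_str A \<delta> \<in> vrels (ultrafilters A) A" by (rule R_str_vrels)
  show "1 \<le> R_str A \<delta> (ultra_unit A x, x)" if "x \<in> A" for x
    by (rule R_str_ultra_unit[OF assms that])
  fix \<XX> x assume \<XX>: "\<XX> \<in> ultrafilters (ultrafilters A)" and x: "x \<in> A"
  let ?u = "ultra_rel (ultrafilters A) A (R_str A \<delta>) (\<XX>, ultra_unit A x)"
  have "?u \<le> \<delta> (S, x)" if "S \<in> ultra_mult A \<XX>" for S
  proof -
    have S: "sharp A S \<in> \<XX>" using that unfolding ultra_mult_def by blast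
    have "{x} \<in> ultra_unit A x" using x unfolding ultra_unit_def by simp
    then have "?u \<le> (SUP (\<zz>, t)\<in>sharp A S \<times> {x}. R_str A \<delta> (\<zz>, t))"
      by (rule ultra_rel_le[OF \<XX> ultra_unit_ultrafilter[OF x] S])
    also have "\<dots> \<le> \<delta> (S, x)"
      using x by (auto simp: sharp_def intro!: SUP_least R_str_le)
    finally show ?thesis .
  qed
  then show "?u \<le> R_str A \<delta> (ultra_mult A \<XX>, x)"
    using x by (simp add: R_str_apply ultra_mult_ultrafilter[OF \<XX>] INF_greatest)
qed

text \<open>The closure axiom is applied to the family consisting of \<open>S\<close> alone: for \<open>S\<close> in the
  multiplication of \<open>\<XX>\<close>, the \<open>ultra_rel\<close>-degree is bounded through sets \<open>T \<in> \<yy>\<close>, and the degree to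
  which \<open>sharp A S\<close> covers \<open>T\<close> under \<open>R_str A \<delta>\<close> is at most that to which \<open>S\<close> covers \<open>T\<close> under \<open>\<delta>\<close>.\<close>

lemma uv_category_R_str:
  fixes \<delta> :: "('a, 'v::quantale) cls"
  assumes cd: "completely_distributive TYPE('v)" and cls: "closure_space A \<delta>"
  shows "uv_category A (R_str A \<delta>)"
  unfolding uv_category_iff
proof (intro conjI ballI)
  show "R_str A \<delta> \<in> vrels (ultrafilters A) A" by (rule R_str_vrels)
  show "1 \<le> R_str A \<delta> (ultra_unit A x, x)" if "x \<in> A" for x
    by (rule R_str_ultra_unit[OF closure_space_imp_preclosure[OF cls] that])
  let ?U = "ultrafilters A" and ?\<alpha> = "R_str A \<delta>"
  fix \<XX> \<yy> x assume \<XX>: "\<XX> \<in> ultrafilters ?U" and \<yy>: "\<yy> \<in> ?U" and x: "x \<in> A"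
  have "ultra_rel ?U A ?\<alpha> (\<XX>, \<yy>) * ?\<alpha> (\<yy>, x) \<le> \<delta> (S, x)" if "S \<in> ultra_mult A \<XX>" for S
  proof -
    have S: "sharp A S \<in> \<XX>" "S \<subseteq> A" using that unfolding ultra_mult_def by auto
    have "ultra_rel ?U A ?\<alpha> (\<XX>, \<yy>) * ?\<alpha> (\<yy>, x)
        \<le> (SUP T\<in>\<yy>. pow_rel ?U A ?\<alpha> (sharp A S, T)) * ?\<alpha> (\<yy>, x)"
      by (intro quantale_mult_mono ultra_rel_le_SUP_pow_rel[OF cd \<XX> \<yy> S(1)]) simp
    also have "\<dots> = (SUP T\<in>\<yy>. pow_rel ?U A ?\<alpha> (sharp A S, T) * ?\<alpha> (\<yy>, x))"
      by (simp add: Sup_mult_distrib image_image)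
    also have "\<dots> \<le> \<delta> (S, x)"
    proof (rule SUP_least)
      fix T assume T: "T \<in> \<yy>"
      have TA: "T \<subseteq> A" by (rule ultrafilter_subset[OF \<yy> T])
      have "pow_rel ?U A ?\<alpha> (sharp A S, T) = (INF t\<in>T. SUP \<zz>\<in>sharp A S. ?\<alpha> (\<zz>, t))"
        using TA by (intro pow_rel_apply) (auto simp: sharp_def)
      also have "\<dots> \<le> (INF t\<in>T. \<delta> (S, t))"
        using TA by (intro INF_superset_mono SUP_least R_str_le) (auto simp: sharp_def)
      finally have "pow_rel ?U A ?\<alpha> (sharp A S, T) * ?\<alpha> (\<yy>, x) \<le> (INF t\<in>T. \<delta> (S, t)) * \<delta> (T, x)"
        by (rule quantale_mult_mono) (rule R_str_le[OF \<yy> x T])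
      also have "\<dots> \<le> \<delta> (S, x)"
        using closure_spaceD(3)[OF cls, of "{S}" T x] S(2) TA x by simp
      finally show "pow_rel ?U A ?\<alpha> (sharp A S, T) * ?\<alpha> (\<yy>, x) \<le> \<delta> (S, x)" .
    qed
    finally show ?thesis .
  qed
  then show "ultra_rel ?U A ?\<alpha> (\<XX>, \<yy>) * ?\<alpha> (\<yy>, x) \<le> ?\<alpha> (ultra_mult A \<XX>, x)"
    using x by (simp add: R_str_apply[of "ultra_mult A \<XX>"] ultra_mult_ultrafilter[OF \<XX>] INF_greatest)
qed

lemma uv_modular_R_str:
  fixes \<delta> :: "('a, 'v::quantale) cls"
  assumes cd: "completely_distributive TYPE('v)" and mod: "cls_modular A h \<delta>"
  shows "uv_modular A h (R_str A \<delta>)"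
  unfolding uv_modular_iff
proof (intro ballI)
  let ?\<alpha> = "R_str A \<delta>"
  fix \<xx> \<yy> x y assume \<xx>: "\<xx> \<in> ultrafilters A" and \<yy>: "\<yy> \<in> ultrafilters A"
    and x: "x \<in> A" and y: "y \<in> A"
  have "ultra_rel A A h (\<xx>, \<yy>) * ?\<alpha> (\<yy>, x) * h (x, y) \<le> \<delta> (S, y)" if S: "S \<in> \<xx>" for S
  proof -
    have "ultra_rel A A h (\<xx>, \<yy>) * ?\<alpha> (\<yy>, x) * h (x, y)
        \<le> (SUP T\<in>\<yy>. pow_rel A A h (S, T)) * ?\<alpha> (\<yy>, x) * h (x, y)"
      by (intro quantale_mult_mono ultra_rel_le_SUP_pow_rel[OF cd \<xx> \<yy> S]) simp_all
    also have "\<dots> = (SUP T\<in>\<yy>. pow_rel A A h (S, T) * ?\<alpha> (\<yy>, x) * h (x, y))"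
      by (simp add: Sup_mult_distrib image_image)
    also have "\<dots> \<le> \<delta> (S, y)"
    proof (rule SUP_least)
      fix T assume T: "T \<in> \<yy>"
      have "pow_rel A A h (S, T) * ?\<alpha> (\<yy>, x) * h (x, y)
          \<le> pow_rel A A h (S, T) * \<delta> (T, x) * h (x, y)"
        by (intro quantale_mult_mono R_str_le[OF \<yy> x T]) simp_all
      also have "\<dots> \<le> \<delta> (S, y)"
        using mod ultrafilter_subset[OF \<xx> S] ultrafilter_subset[OF \<yy> T] x y
        unfolding cls_modular_iff by blast
      finally show "pow_rel A A h (S, T) * ?\<alpha> (\<yy>, x) * h (x, y) \<le> \<delta> (S, y)" .
    qed
    finally show ?thesis .
  qed
  then show "ultra_rel A A h (\<xx>, \<yy>) * ?\<alpha> (\<yy>, x) * h (x, y) \<le> ?\<alpha> (\<xx>, y)"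
    using \<xx> y by (simp add: R_str_apply[of \<xx>] INF_greatest)
qed


section \<open>Unit, counit and their invertibility\<close>

lemma le_R_str_eps_str:
  "\<xx> \<in> ultrafilters A \<Longrightarrow> x \<in> A \<Longrightarrow> \<alpha> (\<xx>, x) \<le> R_str A (eps_str A \<alpha>) (\<xx>, x)"
  by (auto simp: R_str_apply intro!: INF_greatest le_eps_str)

lemma eps_str_R_str_le:
  "S \<subseteq> A \<Longrightarrow> x \<in> A \<Longrightarrow> eps_str A (R_str A \<delta>) (S, x) \<le> \<delta> (S, x)"
  by (auto simp: eps_str_apply sharp_def intro!: SUP_least R_str_le)

text \<open>Let \<open>u\<close> be totally below \<open>R_str A (eps_str A \<alpha>) (\<xx>, x)\<close>. Each \<open>S \<in> \<xx>\<close> then lies in some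
  ultrafilter in \<open>\<Y>\<close>, the set of ultrafilters that converge to \<open>x\<close> to degree at least \<open>u\<close>. So there is an
  ultrafilter \<open>\<XX>\<close> containing \<open>\<Y>\<close> and all \<open>sharp A S\<close>, \<open>S \<in> \<xx>\<close>. The latter force its
  multiplication to be \<open>\<xx>\<close>, the former gives \<open>u\<close> as a lower bound in the unitary graph axiom.\<close>

lemma R_str_eps_str:
  fixes \<alpha> :: "('a, 'v::quantale) uv"
  assumes cd: "completely_distributive TYPE('v)" and gph: "uv_graph A \<alpha>"
  shows "R_str A (eps_str A \<alpha>) = \<alpha>"
proof (rule extensionalityI)
  show "R_str A (eps_str A \<alpha>) \<in> extensional (ultrafilters A \<times> A)"
    "\<alpha> \<in> extensional (ultrafilters A \<times> A)"
    using R_str_vrels uv_graphD(1)[OF gph] unfolding vrels_def by auto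
  fix p assume "p \<in> ultrafilters A \<times> A"
  then obtain \<xx> x where p: "p = (\<xx>, x)" and \<xx>: "\<xx> \<in> ultrafilters A" and x: "x \<in> A" by blast
  have "R_str A (eps_str A \<alpha>) (\<xx>, x) \<le> \<alpha> (\<xx>, x)"
  proof (rule le_if_totally_below_le[OF cd])
    fix u assume u: "u \<lless> R_str A (eps_str A \<alpha>) (\<xx>, x)"
    define \<Y> where "\<Y> = {\<yy> \<in> ultrafilters A. u \<le> \<alpha> (\<yy>, x)}"
    have ne: "\<Y> \<inter> sharp A S \<noteq> {}" if S: "S \<in> \<xx>" for S
    proof -
      have "R_str A (eps_str A \<alpha>) (\<xx>, x) \<le> (SUP \<yy>\<in>sharp A S. \<alpha> (\<yy>, x))"
        using R_str_le[OF \<xx> x S, of "eps_str A \<alpha>"] ultrafilter_subset[OF \<xx> S] x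
        by (simp add: eps_str_apply)
      from totally_below_SUP[OF u this] show ?thesis unfolding \<Y>_def sharp_def by blast
    qed
    \<comment> \<open>The carrier is inserted because \<open>ultrafilter_extending\<close> asks for it; the remaining sets are
      already closed under intersection.\<close>
    let ?\<B> = "insert (ultrafilters A) ((\<lambda>S. \<Y> \<inter> sharp A S) ` \<xx>)"
    obtain \<XX> where \<XX>: "\<XX> \<in> ultrafilters (ultrafilters A)" "?\<B> \<subseteq> \<XX>"
    proof (rule ultrafilter_extending[of ?\<B> "ultrafilters A"])
      show "?\<B> \<subseteq> Pow (ultrafilters A)" unfolding sharp_def by blast
      show "{} \<notin> ?\<B>" using ne \<xx> by blast
      fix P Q assume PQ: "P \<in> ?\<B>" "Q \<in> ?\<B>"
      have "\<Y> \<inter> sharp A S \<inter> (\<Y> \<inter> sharp A T) = \<Y> \<inter> sharp A (S \<inter> T)" if "S \<in> \<xx>" "T \<in> \<xx>" for S T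
        using ultrafilter_subset[OF \<xx>] that unfolding sharp_def
        by (auto intro: ultrafilter_Int ultrafilter_up)
      moreover have "ultrafilters A \<inter> (\<Y> \<inter> sharp A S) = \<Y> \<inter> sharp A S" for S
        unfolding \<Y>_def by blast
      ultimately show "P \<inter> Q \<in> ?\<B>" using PQ ultrafilter_Int[OF \<xx>]
        by (auto simp: Int_commute[of _ "ultrafilters A"])
    qed auto
    have "sharp A S \<in> \<XX>" if "S \<in> \<xx>" for S
      using ultrafilter_up[OF \<XX>(1), of "\<Y> \<inter> sharp A S"] \<XX>(2) that unfolding sharp_def by blast
    then have "\<xx> \<subseteq> ultra_mult A \<XX>"
      using ultrafilter_subset[OF \<xx>] unfolding ultra_mult_def by blast
    then have mult: "\<xx> = ultra_mult A \<XX>"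
      by (rule ultrafilter_maximal[OF \<xx> ultra_mult_ultrafilter[OF \<XX>(1)]])
    have \<Y>: "\<Y> \<inter> sharp A A \<in> \<XX>" using \<XX>(2) ultrafilter_carrier[OF \<xx>] by blast
    have "u \<le> ultra_rel (ultrafilters A) A \<alpha> (\<XX>, ultra_unit A x)"
    proof (rule le_ultra_rel[OF \<XX>(1) ultra_unit_ultrafilter[OF x]])
      fix P Q assume "P \<in> \<XX>" "Q \<in> ultra_unit A x"
      then show "\<exists>\<yy>\<in>P. \<exists>t\<in>Q. u \<le> \<alpha> (\<yy>, t)"
        using ultrafilter_Int_nonempty[OF \<XX>(1) _ \<Y>] unfolding \<Y>_def ultra_unit_def by blast
    qed
    also have "\<dots> \<le> \<alpha> (\<xx>, x)" using uv_graphD(3)[OF gph \<XX>(1) x] mult by simp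
    finally show "u \<le> \<alpha> (\<xx>, x)" .
  qed
  then show "R_str A (eps_str A \<alpha>) p = \<alpha> p"
    unfolding p using le_R_str_eps_str[OF \<xx> x] by (rule antisym)
qed

text \<open>Let \<open>u\<close> be totally below \<open>\<delta> (S, x)\<close>. The sets \<open>T\<close> for which \<open>u\<close> is not totally below
  \<open>\<delta> (T, x)\<close> form an ideal not containing \<open>S\<close>: closure under unions needs \<open>u\<close> to be totally below,
  as \<open>u \<le> sup v w\<close> alone implies neither \<open>u \<le> v\<close> nor \<open>u \<le> w\<close>. An ultrafilter
  containing \<open>S\<close> and missing the ideal converges to \<open>x\<close> to degree at least \<open>u\<close>.\<close>

lemma eps_str_R_str:
  fixes \<delta> :: "('a, 'v::quantale) cls"
  assumes cd: "completely_distributive TYPE('v)" and pre: "preclosure A \<delta>"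
    and joins: "preserves_finite_joins A \<delta>"
  shows "eps_str A (R_str A \<delta>) = \<delta>"
proof (rule extensionalityI)
  show "eps_str A (R_str A \<delta>) \<in> extensional (Pow A \<times> A)" "\<delta> \<in> extensional (Pow A \<times> A)"
    using eps_str_vrels preclosureD(1)[OF pre] unfolding vrels_def by auto
  fix p assume "p \<in> Pow A \<times> A"
  then obtain S x where p: "p = (S, x)" and S: "S \<subseteq> A" and x: "x \<in> A" by blast
  have "\<delta> (S, x) \<le> eps_str A (R_str A \<delta>) (S, x)"
  proof (rule le_if_totally_below_le[OF cd])
    fix u assume u: "u \<lless> \<delta> (S, x)"
    define I where "I = {T. T \<subseteq> A \<and> \<not> u \<lless> \<delta> (T, x)}"
    have I_empty: "{} \<in> I"
      using joins x not_totally_below_bot unfolding I_def preserves_finite_joins_def by auto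
    have I_Un: "T \<union> T' \<in> I" if "T \<in> I" "T' \<in> I" for T T'
      using that joins x totally_below_sup[of u "\<delta> (T, x)" "\<delta> (T', x)"]
      unfolding I_def preserves_finite_joins_def by auto
    have I_down: "\<not> T \<subseteq> T'" if "T' \<in> I" "u \<lless> \<delta> (T, x)" for T T'
      using that totally_below_mono[of u "\<delta> (T, x)" "\<delta> (T', x)"]
        preclosureD(3)[OF pre _ _ x, of T T'] unfolding I_def by auto
    let ?\<B> = "{P. P \<subseteq> A \<and> (\<exists>T\<in>I. S - T \<subseteq> P)}"
    obtain \<xx> where \<xx>: "\<xx> \<in> ultrafilters A" "?\<B> \<subseteq> \<xx>"
    proof (rule ultrafilter_extending[of ?\<B> A])
      show "?\<B> \<subseteq> Pow A" by auto
      show "A \<in> ?\<B>" using S I_empty by auto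
      show "{} \<notin> ?\<B>" using I_down[OF _ u] by auto
      fix P Q assume "P \<in> ?\<B>" "Q \<in> ?\<B>"
      then obtain T T' where "P \<subseteq> A" "T \<in> I" "S - T \<subseteq> P" "T' \<in> I" "S - T' \<subseteq> Q" by auto
      then have "T \<union> T' \<in> I" "P \<inter> Q \<subseteq> A" "S - (T \<union> T') \<subseteq> P \<inter> Q"
        using I_Un by auto
      then show "P \<inter> Q \<in> ?\<B>" by auto
    qed
    have "u \<le> \<delta> (T, x)" if T: "T \<in> \<xx>" for T
    proof (rule ccontr)
      assume "\<not> u \<le> \<delta> (T, x)"
      then have "T \<in> I"
        using totally_below_imp_le ultrafilter_subset[OF \<xx>(1) T] unfolding I_def by blast
      then have "A - T \<in> \<xx>" using \<xx>(2) S by blast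
      from ultrafilter_Int_nonempty[OF \<xx>(1) T this] show False by blast
    qed
    then have "u \<le> R_str A \<delta> (\<xx>, x)" using \<xx>(1) x by (simp add: R_str_apply INF_greatest)
    also have "S \<in> \<xx>" using \<xx>(2) S I_empty by blast
    then have "R_str A \<delta> (\<xx>, x) \<le> eps_str A (R_str A \<delta>) (S, x)"
      by (rule le_eps_str[OF \<xx>(1) _ x])
    finally show "u \<le> eps_str A (R_str A \<delta>) (S, x)" .
  qed
  with eps_str_R_str_le[OF S x] show "eps_str A (R_str A \<delta>) p = \<delta> p"
    unfolding p by (rule antisym)
qed


section \<open>Normalisation\<close>

definition uv_induced :: "'a set \<Rightarrow> ('a, 'v::quantale) uv \<Rightarrow> ('a, 'a, 'v) vrel" where
  "uv_induced A \<alpha> = (\<lambda>(x, y)\<in>A \<times> A. \<alpha> (ultra_unit A x, y))"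

definition cls_induced :: "'a set \<Rightarrow> ('a, 'v::quantale) cls \<Rightarrow> ('a, 'a, 'v) vrel" where
  "cls_induced A \<delta> = (\<lambda>(x, y)\<in>A \<times> A. \<delta> ({x}, y))"

lemma induced_apply:
  "x \<in> A \<Longrightarrow> y \<in> A \<Longrightarrow> uv_induced A \<alpha> (x, y) = \<alpha> (ultra_unit A x, y)"
  "x \<in> A \<Longrightarrow> y \<in> A \<Longrightarrow> cls_induced A \<delta> (x, y) = \<delta> ({x}, y)"
  unfolding uv_induced_def cls_induced_def by simp_all

lemma cls_induced_eps_str: "cls_induced A (eps_str A \<alpha>) = uv_induced A \<alpha>"
  unfolding cls_induced_def uv_induced_def by (auto simp: eps_str_singleton restrict_def fun_eq_iff)

text \<open>Transitivity at the principal ultrafilter on \<open>\<xx>\<close>, whose multiplication is \<open>\<xx>\<close>.\<close>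

lemma uv_category_act_right:
  assumes cat: "uv_category A \<alpha>" and \<xx>: "\<xx> \<in> ultrafilters A" and x: "x \<in> A" and y: "y \<in> A"
  shows "\<alpha> (\<xx>, x) * \<alpha> (ultra_unit A x, y) \<le> \<alpha> (\<xx>, y)"
proof -
  let ?U = "ultrafilters A"
  have \<XX>: "ultra_unit ?U \<xx> \<in> ultrafilters ?U" by (rule ultra_unit_ultrafilter[OF \<xx>])
  have "\<alpha> (\<xx>, x) \<le> ultra_rel ?U A \<alpha> (ultra_unit ?U \<xx>, ultra_unit A x)"
    by (rule le_ultra_rel[OF \<XX> ultra_unit_ultrafilter[OF x]]) (auto simp: ultra_unit_def)
  then have "\<alpha> (\<xx>, x) * \<alpha> (ultra_unit A x, y)
      \<le> ultra_rel ?U A \<alpha> (ultra_unit ?U \<xx>, ultra_unit A x) * \<alpha> (ultra_unit A x, y)"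
    by (rule quantale_mult_mono) simp
  also have "\<dots> \<le> \<alpha> (\<xx>, y)"
    using uv_categoryD(3)[OF cat \<XX> ultra_unit_ultrafilter[OF x] y]
    by (simp add: ultra_mult_ultra_unit[OF \<xx>])
  finally show ?thesis .
qed

text \<open>Transitivity at the image of \<open>\<xx>\<close> under \<open>ultra_unit A\<close>, whose multiplication is \<open>\<xx>\<close> as well.\<close>

lemma uv_category_act_left:
  assumes cat: "uv_category A \<alpha>" and \<xx>: "\<xx> \<in> ultrafilters A" and \<yy>: "\<yy> \<in> ultrafilters A"
    and x: "x \<in> A"
  shows "ultra_rel A A (uv_induced A \<alpha>) (\<xx>, \<yy>) * \<alpha> (\<yy>, x) \<le> \<alpha> (\<xx>, x)"
proof -
  let ?U = "ultrafilters A"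
  define \<XX> where "\<XX> = ultra_map A ?U (ultra_unit A) \<xx>"
  have \<XX>: "\<XX> \<in> ultrafilters ?U"
    unfolding \<XX>_def by (intro ultra_map_ultrafilter[OF \<xx>]) (auto intro: ultra_unit_ultrafilter)
  have "ultra_rel A A (uv_induced A \<alpha>) (\<xx>, \<yy>) \<le> ultra_rel ?U A \<alpha> (\<XX>, \<yy>)"
  proof -
    have "ultra_rel A A (uv_induced A \<alpha>) (\<xx>, \<yy>) \<le> (SUP (\<zz>, t)\<in>P \<times> T. \<alpha> (\<zz>, t))"
      if P: "P \<in> \<XX>" and T: "T \<in> \<yy>" for P T
    proof -
      let ?S = "ultra_unit A -` P \<inter> A"
      have "?S \<in> \<xx>" using P unfolding \<XX>_def ultra_map_def by blast
      then have "ultra_rel A A (uv_induced A \<alpha>) (\<xx>, \<yy>)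
          \<le> (SUP (s, t)\<in>?S \<times> T. uv_induced A \<alpha> (s, t))"
        by (rule ultra_rel_le[OF \<xx> \<yy> _ T])
      also have "\<dots> \<le> (SUP (\<zz>, t)\<in>P \<times> T. \<alpha> (\<zz>, t))"
      proof (rule SUP_least, clarify)
        fix s t assume "s \<in> A" "ultra_unit A s \<in> P" "t \<in> T"
        moreover from this have "t \<in> A" using ultrafilter_subset[OF \<yy> T] by blast
        ultimately show "uv_induced A \<alpha> (s, t) \<le> (SUP (\<zz>, t)\<in>P \<times> T. \<alpha> (\<zz>, t))"
          by (intro SUP_upper2[of "(ultra_unit A s, t)"]) (auto simp: induced_apply)
      qed
      finally show ?thesis .
    qed
    then show ?thesis
      using \<XX> \<yy> unfolding ultra_rel_def[of ?U] by (auto intro!: INF_greatest)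
  qed
  then have "ultra_rel A A (uv_induced A \<alpha>) (\<xx>, \<yy>) * \<alpha> (\<yy>, x)
      \<le> ultra_rel ?U A \<alpha> (\<XX>, \<yy>) * \<alpha> (\<yy>, x)"
    by (rule quantale_mult_mono) simp
  also have "\<dots> \<le> \<alpha> (\<xx>, x)"
    using uv_categoryD(3)[OF cat \<XX> \<yy> x]
    by (simp add: \<XX>_def ultra_mult_ultra_map_ultra_unit[OF \<xx>])
  finally show ?thesis .
qed

lemma vcategory_uv_induced:
  assumes "uv_category A \<alpha>"
  shows "vcategory A (uv_induced A \<alpha>)"
  unfolding vcategory_iff
proof (intro conjI ballI)
  show "uv_induced A \<alpha> \<in> vrels A A" unfolding uv_induced_def vrels_def by simp
qed (simp_all add: induced_apply uv_categoryD(2)[OF assms]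
    uv_category_act_right[OF assms ultra_unit_ultrafilter])

lemma uv_modular_uv_induced:
  assumes cat: "uv_category A \<alpha>"
  shows "uv_modular A (uv_induced A \<alpha>) \<alpha>"
  unfolding uv_modular_iff
proof (intro ballI)
  fix \<xx> \<yy> x y assume *: "\<xx> \<in> ultrafilters A" "\<yy> \<in> ultrafilters A" "x \<in> A" "y \<in> A"
  have "ultra_rel A A (uv_induced A \<alpha>) (\<xx>, \<yy>) * \<alpha> (\<yy>, x) * uv_induced A \<alpha> (x, y)
      \<le> \<alpha> (\<xx>, x) * \<alpha> (ultra_unit A x, y)"
    using * by (intro quantale_mult_mono uv_category_act_left[OF cat]) (simp_all add: induced_apply)
  also have "\<dots> \<le> \<alpha> (\<xx>, y)" using * by (intro uv_category_act_right[OF cat])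
  finally show "ultra_rel A A (uv_induced A \<alpha>) (\<xx>, \<yy>) * \<alpha> (\<yy>, x) * uv_induced A \<alpha> (x, y)
      \<le> \<alpha> (\<xx>, y)" .
qed

text \<open>The induced \<open>'v\<close>-category is the largest one for which the structure is modular: reflexivity
  makes the first two factors of the modularity inequality at \<open>ultra_unit A x\<close> at least the unit.
  This is the unit of the adjunction between forgetting and normalising.\<close>

lemma le_uv_induced:
  assumes h: "vcategory A h" and cat: "uv_category A \<alpha>" and mod: "uv_modular A h \<alpha>"
    and x: "x \<in> A" and y: "y \<in> A"
  shows "h (x, y) \<le> uv_induced A \<alpha> (x, y)"
proof -
  let ?\<xx> = "ultra_unit A x"
  have \<xx>: "?\<xx> \<in> ultrafilters A" by (rule ultra_unit_ultrafilter[OF x])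
  have "1 \<le> ultra_rel A A h (?\<xx>, ?\<xx>)"
    using h x by (intro le_ultra_rel[OF \<xx> \<xx>] bexI[of _ x]) (auto simp: vcategory_iff ultra_unit_def)
  then have "1 * 1 * h (x, y) \<le> ultra_rel A A h (?\<xx>, ?\<xx>) * \<alpha> (?\<xx>, x) * h (x, y)"
    by (intro quantale_mult_mono uv_categoryD(2)[OF cat x]) simp_all
  also have "\<dots> \<le> \<alpha> (?\<xx>, y)" using mod \<xx> x y unfolding uv_modular_iff by blast
  finally show ?thesis using x y by (simp add: induced_apply)
qed

lemma closure_space_act_right:
  assumes "closure_space A \<delta>" "S \<subseteq> A" "x \<in> A" "y \<in> A"
  shows "\<delta> (S, x) * \<delta> ({x}, y) \<le> \<delta> (S, y)"
  using closure_spaceD(3)[OF assms(1), of "{S}" "{x}" y] assms(2-4) by simp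

text \<open>The closure axiom for the family of singletons of \<open>S\<close>.\<close>

lemma closure_space_act_left:
  assumes cls: "closure_space A \<delta>" and S: "S \<subseteq> A" and T: "T \<subseteq> A" and x: "x \<in> A"
  shows "pow_rel A A (cls_induced A \<delta>) (S, T) * \<delta> (T, x) \<le> \<delta> (S, x)"
proof -
  have "pow_rel A A (cls_induced A \<delta>) (S, T) = (INF t\<in>T. SUP s\<in>S. \<delta> ({s}, t))"
    using S T by (simp add: pow_rel_apply)
      (intro INF_cong SUP_cong refl, auto simp: induced_apply subset_iff)
  moreover have "(INF t\<in>T. SUP s\<in>S. \<delta> ({s}, t)) * \<delta> (T, x) \<le> \<delta> (S, x)"
    using closure_spaceD(3)[OF cls, of "(\<lambda>s. {s}) ` S" T x] S T x by (auto simp: image_image)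
  ultimately show ?thesis by simp
qed

lemma vcategory_cls_induced:
  assumes "closure_space A \<delta>"
  shows "vcategory A (cls_induced A \<delta>)"
  unfolding vcategory_iff
proof (intro conjI ballI)
  show "cls_induced A \<delta> \<in> vrels A A" unfolding cls_induced_def vrels_def by simp
qed (simp_all add: induced_apply closure_spaceD(2)[OF assms] closure_space_act_right[OF assms])

lemma cls_modular_cls_induced:
  assumes cls: "closure_space A \<delta>"
  shows "cls_modular A (cls_induced A \<delta>) \<delta>"
  unfolding cls_modular_iff
proof (intro ballI allI impI)
  fix S T x y assume *: "S \<subseteq> A" "T \<subseteq> A" "x \<in> A" "y \<in> A"
  have "pow_rel A A (cls_induced A \<delta>) (S, T) * \<delta> (T, x) * cls_induced A \<delta> (x, y)
      \<le> \<delta> (S, x) * \<delta> ({x}, y)"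
    using * by (intro quantale_mult_mono closure_space_act_left[OF cls]) (simp_all add: induced_apply)
  also have "\<dots> \<le> \<delta> (S, y)" using * by (intro closure_space_act_right[OF cls])
  finally show "pow_rel A A (cls_induced A \<delta>) (S, T) * \<delta> (T, x) * cls_induced A \<delta> (x, y)
      \<le> \<delta> (S, y)" .
qed

lemma le_cls_induced:
  assumes h: "vcategory A h" and cls: "closure_space A \<delta>" and mod: "cls_modular A h \<delta>"
    and x: "x \<in> A" and y: "y \<in> A"
  shows "h (x, y) \<le> cls_induced A \<delta> (x, y)"
proof -
  have "1 \<le> pow_rel A A h ({x}, {x})"
    using h x by (simp add: pow_rel_apply vcategory_iff)
  then have "1 * 1 * h (x, y) \<le> pow_rel A A h ({x}, {x}) * \<delta> ({x}, x) * h (x, y)"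
    by (intro quantale_mult_mono closure_spaceD(2)[OF cls x]) simp_all
  also have "\<dots> \<le> \<delta> ({x}, y)" using mod x y unfolding cls_modular_iff by blast
  finally show ?thesis using x y by (simp add: induced_apply)
qed


section \<open>Morphisms\<close>

lemma uv_mor_iff:
  "uv_mor (A, \<alpha>) (C, \<gamma>) f \<longleftrightarrow>
    (\<forall>\<xx>\<in>ultrafilters A. \<forall>x\<in>A. \<alpha> (\<xx>, x) \<le> \<gamma> (ultra_map A C f \<xx>, f x))"
  unfolding uv_mor_def by simp

lemma cls_mor_iff:
  "cls_mor (A, \<delta>) (C, \<zeta>) f \<longleftrightarrow> (\<forall>S\<in>Pow A. \<forall>x\<in>A. \<delta> (S, x) \<le> \<zeta> (f ` S, f x))"
  unfolding cls_mor_def by simp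

lemma uv_mod_mor_iff:
  "uv_mod_mor (A, h, \<alpha>) (C, g, \<gamma>) f \<longleftrightarrow> vfunctor A h g f \<and> uv_mor (A, \<alpha>) (C, \<gamma>) f"
  unfolding uv_mod_mor_def by simp

lemma cls_mod_mor_iff:
  "cls_mod_mor (A, h, \<delta>) (C, g, \<zeta>) f \<longleftrightarrow> vfunctor A h g f \<and> cls_mor (A, \<delta>) (C, \<zeta>) f"
  unfolding cls_mod_mor_def by simp

lemma uv_mor_idI:
  "(\<And>\<xx> x. \<xx> \<in> ultrafilters A \<Longrightarrow> x \<in> A \<Longrightarrow> \<alpha> (\<xx>, x) \<le> \<beta> (\<xx>, x)) \<Longrightarrow>
    uv_mor (A, \<alpha>) (A, \<beta>) (\<lambda>x\<in>A. x)"
  unfolding uv_mor_iff by (simp add: ultra_map_idmap)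

lemma uv_mor_compose:
  assumes "uv_mor (A, \<alpha>) (C, \<gamma>) f" "uv_mor (C, \<gamma>) (D, \<beta>) g" "f \<in> A \<rightarrow>\<^sub>E C"
  shows "uv_mor (A, \<alpha>) (D, \<beta>) (compose A g f)"
  unfolding uv_mor_iff
proof (clarify)
  fix \<xx> x assume \<xx>: "\<xx> \<in> ultrafilters A" and x: "x \<in> A"
  have f: "f ` A \<subseteq> C" using assms(3) by auto
  have "\<alpha> (\<xx>, x) \<le> \<gamma> (ultra_map A C f \<xx>, f x)"
    using assms(1) \<xx> x unfolding uv_mor_iff by blast
  also have "\<dots> \<le> \<beta> (ultra_map C D g (ultra_map A C f \<xx>), g (f x))"
    using assms(2) ultra_map_ultrafilter[OF \<xx> f] f x unfolding uv_mor_iff by blast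
  finally show "\<alpha> (\<xx>, x) \<le> \<beta> (ultra_map A D (compose A g f) \<xx>, compose A g f x)"
    using f x by (simp add: ultra_map_compose compose_eq)
qed

lemma cls_mor_idI:
  assumes "\<And>S x. S \<subseteq> A \<Longrightarrow> x \<in> A \<Longrightarrow> \<delta> (S, x) \<le> \<zeta> (S, x)"
  shows "cls_mor (A, \<delta>) (A, \<zeta>) (\<lambda>x\<in>A. x)"
proof -
  have "(\<lambda>x\<in>A. x) ` S = S" if "S \<subseteq> A" for S using that by force
  then show ?thesis unfolding cls_mor_iff using assms by simp
qed

lemma cls_mor_compose:
  assumes "cls_mor (A, \<delta>) (C, \<zeta>) f" "cls_mor (C, \<zeta>) (D, \<xi>) g" "f \<in> A \<rightarrow>\<^sub>E C"
  shows "cls_mor (A, \<delta>) (D, \<xi>) (compose A g f)"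
  unfolding cls_mor_iff
proof (clarify)
  fix S x assume S: "S \<subseteq> A" and x: "x \<in> A"
  have f: "f ` S \<subseteq> C" "f x \<in> C" using assms(3) S x by auto
  have "\<delta> (S, x) \<le> \<zeta> (f ` S, f x)" using assms(1) S x unfolding cls_mor_iff by blast
  also have "\<dots> \<le> \<xi> (g ` f ` S, g (f x))" using assms(2) f unfolding cls_mor_iff by blast
  also have "g ` f ` S = compose A g f ` S" using S by (force simp: compose_def)
  finally show "\<delta> (S, x) \<le> \<xi> (compose A g f ` S, compose A g f x)"
    using x by (simp add: compose_eq)
qed

lemma vfunctor_compose:
  assumes "vfunctor A h g f" "vfunctor C g e f'" "f \<in> A \<rightarrow>\<^sub>E C"
  shows "vfunctor A h e (compose A f' f)"
  unfolding vfunctor_def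
proof (intro ballI)
  fix x y assume xy: "x \<in> A" "y \<in> A"
  then have "f x \<in> C" "f y \<in> C" using assms(3) by auto
  then have "g (f x, f y) \<le> e (f' (f x), f' (f y))" using assms(2) unfolding vfunctor_def by simp
  moreover have "h (x, y) \<le> g (f x, f y)" using assms(1) xy unfolding vfunctor_def by simp
  ultimately show "h (x, y) \<le> e (compose A f' f x, compose A f' f y)"
    using xy by (simp add: compose_eq)
qed

lemma vfunctor_idI:
  "(\<And>x y. x \<in> A \<Longrightarrow> y \<in> A \<Longrightarrow> h (x, y) \<le> g (x, y)) \<Longrightarrow> vfunctor A h g (\<lambda>x\<in>A. x)"
  unfolding vfunctor_def by simp

lemma cls_mor_eps_str:
  assumes mor: "uv_mor (A, \<alpha>) (C, \<gamma>) f" and f: "f \<in> A \<rightarrow>\<^sub>E C"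
  shows "cls_mor (A, eps_str A \<alpha>) (C, eps_str C \<gamma>) f"
  unfolding cls_mor_iff
proof (clarify)
  fix S x assume S: "S \<subseteq> A" and x: "x \<in> A"
  have fA: "f ` A \<subseteq> C" using f by auto
  have "\<alpha> (\<xx>, x) \<le> eps_str C \<gamma> (f ` S, f x)" if "\<xx> \<in> sharp A S" for \<xx>
  proof -
    have \<xx>: "\<xx> \<in> ultrafilters A" "S \<in> \<xx>" using that unfolding sharp_def by auto
    have "f -` (f ` S) \<inter> A \<in> \<xx>" using S by (intro ultrafilter_up[OF \<xx>]) auto
    then have "f ` S \<in> ultra_map A C f \<xx>" using fA S unfolding ultra_map_def by blast
    then have "\<gamma> (ultra_map A C f \<xx>, f x) \<le> eps_str C \<gamma> (f ` S, f x)"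
      using fA x by (intro le_eps_str ultra_map_ultrafilter[OF \<xx>(1)]) auto
    moreover have "\<alpha> (\<xx>, x) \<le> \<gamma> (ultra_map A C f \<xx>, f x)"
      using mor \<xx>(1) x unfolding uv_mor_iff by blast
    ultimately show ?thesis by (rule order_trans[rotated])
  qed
  then show "eps_str A \<alpha> (S, x) \<le> eps_str C \<gamma> (f ` S, f x)"
    using S x by (simp add: eps_str_apply[of S] SUP_least)
qed

lemma uv_mor_R_str:
  assumes mor: "cls_mor (A, \<delta>) (C, \<zeta>) f" and f: "f \<in> A \<rightarrow>\<^sub>E C" and pre: "preclosure C \<zeta>"
  shows "uv_mor (A, R_str A \<delta>) (C, R_str C \<zeta>) f"
  unfolding uv_mor_iff
proof (clarify)
  fix \<xx> x assume \<xx>: "\<xx> \<in> ultrafilters A" and x: "x \<in> A"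
  have fA: "f ` A \<subseteq> C" "f x \<in> C" using f x by auto
  have "R_str A \<delta> (\<xx>, x) \<le> \<zeta> (T, f x)" if "T \<in> ultra_map A C f \<xx>" for T
  proof -
    let ?S = "f -` T \<inter> A"
    have T: "T \<subseteq> C" "?S \<in> \<xx>" using that unfolding ultra_map_def by auto
    have "R_str A \<delta> (\<xx>, x) \<le> \<delta> (?S, x)" by (rule R_str_le[OF \<xx> x T(2)])
    also have "\<dots> \<le> \<zeta> (f ` ?S, f x)" using mor x unfolding cls_mor_iff by blast
    also have "\<dots> \<le> \<zeta> (T, f x)" using T(1) fA by (intro preclosureD(3)[OF pre]) auto
    finally show ?thesis .
  qed
  then show "R_str A \<delta> (\<xx>, x) \<le> R_str C \<zeta> (ultra_map A C f \<xx>, f x)"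
    using fA by (simp add: R_str_apply[of "ultra_map A C f \<xx>"] ultra_map_ultrafilter[OF \<xx>] INF_greatest)
qed

lemma vfunctor_uv_induced:
  assumes mor: "uv_mor (A, \<alpha>) (C, \<gamma>) f" and f: "f \<in> A \<rightarrow>\<^sub>E C"
  shows "vfunctor A (uv_induced A \<alpha>) (uv_induced C \<gamma>) f"
  unfolding vfunctor_def
proof (intro ballI)
  fix x y assume xy: "x \<in> A" "y \<in> A"
  then have fxy: "f x \<in> C" "f y \<in> C" using f by auto
  have "\<alpha> (ultra_unit A x, y) \<le> \<gamma> (ultra_map A C f (ultra_unit A x), f y)"
    using mor xy ultra_unit_ultrafilter[OF xy(1)] unfolding uv_mor_iff by simp
  then show "uv_induced A \<alpha> (x, y) \<le> uv_induced C \<gamma> (f x, f y)"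
    using xy fxy by (simp add: induced_apply ultra_map_ultra_unit)
qed

lemma vfunctor_cls_induced:
  assumes mor: "cls_mor (A, \<delta>) (C, \<zeta>) f" and f: "f \<in> A \<rightarrow>\<^sub>E C"
  shows "vfunctor A (cls_induced A \<delta>) (cls_induced C \<zeta>) f"
  unfolding vfunctor_def
proof (intro ballI)
  fix x y assume xy: "x \<in> A" "y \<in> A"
  then have fxy: "f x \<in> C" "f y \<in> C" using f by auto
  have "\<delta> ({x}, y) \<le> \<zeta> (f ` {x}, f y)" using mor xy unfolding cls_mor_iff by blast
  then show "cls_induced A \<delta> (x, y) \<le> cls_induced C \<zeta> (f x, f y)"
    using xy fxy by (simp add: induced_apply)
qed


section \<open>Categories of structured sets\<close>

lemma set_cat_simps:
  "Obj (set_cat Ob mor) = Ob"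
  "Hom (set_cat Ob mor) X Y = {f \<in> fst X \<rightarrow>\<^sub>E fst Y. mor X Y f}"
  "Id (set_cat Ob mor) X = (\<lambda>x\<in>fst X. x)"
  "Comp (set_cat Ob mor) X Y Z g f = compose (fst X) g f"
  unfolding set_cat_def by simp_all

lemma set_ftor_simps: "Fob (set_ftor F) X = F X" "Far (set_ftor F) X Y f = f"
  unfolding set_ftor_def by simp_all

lemma fid_conv: "fid = set_ftor (\<lambda>X. X)"
  unfolding fid_def set_ftor_def by simp

lemma fcomp_set_ftor: "set_ftor G \<circ>\<^sub>F set_ftor F = set_ftor (\<lambda>X. G (F X))"
  unfolding fcomp_def set_ftor_def by simp

lemma full_subcat_set_cat: "full_subcat (set_cat Ob mor) P = set_cat {X \<in> Ob. P X} mor"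
  unfolding full_subcat_def set_cat_def by simp

lemma category_set_cat:
  assumes "\<And>X. X \<in> Ob \<Longrightarrow> mor X X (\<lambda>x\<in>fst X. x)"
    and "\<And>X Y Z f g. \<lbrakk>X \<in> Ob; Y \<in> Ob; Z \<in> Ob; f \<in> fst X \<rightarrow>\<^sub>E fst Y; g \<in> fst Y \<rightarrow>\<^sub>E fst Z;
      mor X Y f; mor Y Z g\<rbrakk> \<Longrightarrow> mor X Z (compose (fst X) g f)"
  shows "category (set_cat Ob mor)"
proof
  show "Comp (set_cat Ob mor) X Y Y (Id (set_cat Ob mor) Y) f = f"
    if "f \<in> Hom (set_cat Ob mor) X Y" for X Y f
    using that unfolding set_cat_simps by (auto intro!: Id_compose simp: PiE_iff)
  show "Comp (set_cat Ob mor) X X Y f (Id (set_cat Ob mor) X) = f"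
    if "f \<in> Hom (set_cat Ob mor) X Y" for X Y f
    using that unfolding set_cat_simps by (auto intro!: compose_Id simp: PiE_iff)
  show "Comp (set_cat Ob mor) X Z V h (Comp (set_cat Ob mor) X Y Z g f)
      = Comp (set_cat Ob mor) X Y V (Comp (set_cat Ob mor) Y Z V h g) f"
    if "f \<in> Hom (set_cat Ob mor) X Y" for X Y Z V f g h
    using that unfolding set_cat_simps by (auto intro!: compose_assoc)
  show "Comp (set_cat Ob mor) X Y Z g f \<in> Hom (set_cat Ob mor) X Z"
    if "X \<in> Obj (set_cat Ob mor)" "Y \<in> Obj (set_cat Ob mor)" "Z \<in> Obj (set_cat Ob mor)"
      "f \<in> Hom (set_cat Ob mor) X Y" "g \<in> Hom (set_cat Ob mor) Y Z" for X Y Z f g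
    using that assms(2) unfolding set_cat_simps
    by (auto simp: compose_def PiE_iff)
qed (auto simp: set_cat_simps assms(1))

text \<open>Since maps are unchanged, functoriality is the preservation of objects, underlying sets and the
  defining property of morphisms.\<close>

lemma cat_functor_set_ftor:
  assumes "category (set_cat Ob mor)" "category (set_cat Ob' mor')"
    and "\<And>X. X \<in> Ob \<Longrightarrow> F X \<in> Ob' \<and> fst (F X) = fst X"
    and "\<And>X Y f. \<lbrakk>X \<in> Ob; Y \<in> Ob; f \<in> fst X \<rightarrow>\<^sub>E fst Y; mor X Y f\<rbrakk> \<Longrightarrow> mor' (F X) (F Y) f"
  shows "cat_functor (set_cat Ob mor) (set_cat Ob' mor') (set_ftor F)"
proof -
  interpret dom: category "set_cat Ob mor" by fact
  interpret cod: category "set_cat Ob' mor'" by fact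
  show ?thesis by standard (auto simp: set_cat_simps set_ftor_simps assms(3,4))
qed

text \<open>Naturality and the triangle identities hold because all components are identity maps; the only
  requirement is that these are morphisms in the stated directions.\<close>

lemma adjunction_set_ftor:
  assumes F: "cat_functor (set_cat Ob mor) (set_cat Ob' mor') (set_ftor F)"
    and G: "cat_functor (set_cat Ob' mor') (set_cat Ob mor) (set_ftor G)"
    and fst_F: "\<And>X. X \<in> Ob \<Longrightarrow> fst (F X) = fst X"
    and fst_G: "\<And>Y. Y \<in> Ob' \<Longrightarrow> fst (G Y) = fst Y"
    and unit: "\<And>X. X \<in> Ob \<Longrightarrow> mor X (G (F X)) (\<lambda>x\<in>fst X. x)"
    and counit: "\<And>Y. Y \<in> Ob' \<Longrightarrow> mor' (F (G Y)) Y (\<lambda>x\<in>fst Y. x)"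
  shows "adjunction (set_cat Ob mor) (set_cat Ob' mor') (set_ftor F) (set_ftor G) idmap idmap"
proof -
  let ?C = "set_cat Ob mor" and ?D = "set_cat Ob' mor'"
  interpret F: cat_functor ?C ?D "set_ftor F" by (rule F)
  interpret G: cat_functor ?D ?C "set_ftor G" by (rule G)
  have FOb: "F X \<in> Ob'" if "X \<in> Ob" for X
    using F.Fob_in_Obj that by (simp add: set_cat_simps set_ftor_simps)
  have GOb: "G Y \<in> Ob" if "Y \<in> Ob'" for Y
    using G.Fob_in_Obj that by (simp add: set_cat_simps set_ftor_simps)
  have Far: "mor' (F X) (F Y) f" if "X \<in> Ob" "Y \<in> Ob" "f \<in> fst X \<rightarrow>\<^sub>E fst Y" "mor X Y f" for X Y f
    using F.Far_in_Hom[of X Y f] that by (simp add: set_cat_simps set_ftor_simps)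
  have Gar: "mor (G X) (G Y) f" if "X \<in> Ob'" "Y \<in> Ob'" "f \<in> fst X \<rightarrow>\<^sub>E fst Y" "mor' X Y f" for X Y f
    using G.Far_in_Hom[of X Y f] that by (simp add: set_cat_simps set_ftor_simps)
  have ids: "compose A f (\<lambda>x\<in>A. x) = f" "compose A (\<lambda>x\<in>B. x) f = f" if "f \<in> A \<rightarrow>\<^sub>E B"
    for A B :: "'a set" and f
    using that compose_Id[of f A B] Id_compose[of f A B] by (auto simp: PiE_iff)
  have self: "(\<lambda>x\<in>A. x) \<in> A \<rightarrow>\<^sub>E A" for A :: "'a set" by auto
  have I: "cat_functor ?C ?C fid" "cat_functor ?D ?D fid"
    unfolding fid_conv by (intro cat_functor_set_ftor F.dom.category_axioms F.cod.category_axioms; simp)+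
  have GF: "cat_functor ?C ?C (set_ftor G \<circ>\<^sub>F set_ftor F)"
    unfolding fcomp_set_ftor
    by (intro cat_functor_set_ftor F.dom.category_axioms)
      (auto simp: FOb GOb fst_F fst_G intro!: Far Gar)
  have FG: "cat_functor ?D ?D (set_ftor F \<circ>\<^sub>F set_ftor G)"
    unfolding fcomp_set_ftor
    by (intro cat_functor_set_ftor F.cod.category_axioms)
      (auto simp: FOb GOb fst_F fst_G intro!: Far Gar)
  have u: "nat_trans ?C ?C fid (set_ftor G \<circ>\<^sub>F set_ftor F) idmap"
    by (intro nat_trans.intro I GF nat_trans_axioms.intro)
      (auto simp: fid_conv fcomp_set_ftor set_cat_simps set_ftor_simps idmap_def
        fst_F fst_G FOb unit ids)
  have c: "nat_trans ?D ?D (set_ftor F \<circ>\<^sub>F set_ftor G) fid idmap"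
    by (intro nat_trans.intro I FG nat_trans_axioms.intro)
      (auto simp: fid_conv fcomp_set_ftor set_cat_simps set_ftor_simps idmap_def
        fst_F fst_G GOb counit ids)
  show ?thesis
    by (intro adjunction.intro F G u c adjunction_axioms.intro)
      (auto simp: set_cat_simps set_ftor_simps idmap_def fst_F fst_G FOb GOb ids(1)[OF self])
qed

lemma functor_eq_set_ftor:
  assumes "cat_functor C D (set_ftor F)" and "\<And>X. X \<in> Obj C \<Longrightarrow> F X = G X"
  shows "functor_eq C D (set_ftor F) (set_ftor G)"
proof -
  interpret F: cat_functor C D "set_ftor F" by fact
  have "cat_functor C D (set_ftor G)"
    using F.Fob_in_Obj F.Far_in_Hom F.Far_Id F.Far_Comp assms(2)
    by (intro cat_functor.intro F.dom.category_axioms F.cod.category_axioms cat_functor_axioms.intro)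
      (auto simp: set_ftor_simps)
  then show ?thesis
    using assms unfolding functor_eq_def by (simp add: set_ftor_simps)
qed

lemma cat_functor_fcomp:
  assumes "cat_functor C D F" "cat_functor D E G"
  shows "cat_functor C E (G \<circ>\<^sub>F F)"
proof -
  interpret F: cat_functor C D F by fact
  interpret G: cat_functor D E G by fact
  show ?thesis
    by standard (auto simp: fcomp_def F.Fob_in_Obj G.Fob_in_Obj F.Far_in_Hom G.Far_in_Hom
        F.Far_Id G.Far_Id F.Far_Comp G.Far_Comp)
qed

lemma cat_iso_set_ftor:
  assumes F: "cat_functor C D (set_ftor F)" and G: "cat_functor D C (set_ftor G)"
    and "\<And>X. X \<in> Obj C \<Longrightarrow> G (F X) = X" "\<And>Y. Y \<in> Obj D \<Longrightarrow> F (G Y) = Y"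
  shows "cat_iso C D (set_ftor F) (set_ftor G)"
  unfolding cat_iso_def fcomp_set_ftor fid_conv
  using cat_functor_fcomp[OF F G] cat_functor_fcomp[OF G F] assms
  by (auto simp: fcomp_set_ftor intro!: functor_eq_set_ftor)


section \<open>The categories and functors at hand\<close>

lemma category_UV: "category UVCat" "category UVUGph"
  unfolding UVCat_def UVUGph_def
  by (rule category_set_cat; auto intro: uv_mor_idI uv_mor_compose)+

lemma category_V: "category VCls" "category VPreCls"
  unfolding VCls_def VPreCls_def
  by (rule category_set_cat; auto intro: cls_mor_idI cls_mor_compose)+

lemma category_UVMod: "category UVModCat" "category UVModUGph"
  unfolding UVModCat_def UVModUGph_def
  by (rule category_set_cat; auto simp: uv_mod_mor_iff
      intro: uv_mor_idI uv_mor_compose vfunctor_idI vfunctor_compose)+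

lemma category_VMod: "category VModCls" "category VModPreCls"
  unfolding VModCls_def VModPreCls_def
  by (rule category_set_cat; auto simp: cls_mod_mor_iff
      intro: cls_mor_idI cls_mor_compose vfunctor_idI vfunctor_compose)+

lemma VModTop_conv:
  "VModTop = set_cat {(A, h, \<delta>). vcategory A h \<and> closure_space A \<delta> \<and> cls_modular A h \<delta>
     \<and> preserves_finite_joins A \<delta>} cls_mod_mor"
  unfolding VModTop_def VModCls_def full_subcat_set_cat
  by (rule arg_cong[where f = "\<lambda>Ob. set_cat Ob cls_mod_mor"]) auto

lemma VModPreTop_conv:
  "VModPreTop = set_cat {(A, h, \<delta>). vcategory A h \<and> preclosure A \<delta> \<and> cls_modular A h \<delta>
     \<and> preserves_finite_joins A \<delta>} cls_mod_mor"
  unfolding VModPreTop_def VModPreCls_def full_subcat_set_cat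
  by (rule arg_cong[where f = "\<lambda>Ob. set_cat Ob cls_mod_mor"]) auto

lemma category_VModTop: "category VModTop" "category VModPreTop"
  unfolding VModTop_conv VModPreTop_conv
  by (rule category_set_cat; auto simp: cls_mod_mor_iff
      intro: cls_mor_idI cls_mor_compose vfunctor_idI vfunctor_compose)+

lemmas cat_defs = UVCat_def UVUGph_def VCls_def VPreCls_def UVModCat_def UVModUGph_def
  VModCls_def VModPreCls_def VModTop_conv VModPreTop_conv

lemma cat_functor_forget_V:
  "cat_functor UVModCat UVCat forget_V" "cat_functor UVModUGph UVUGph forget_V"
  "cat_functor VModCls VCls forget_V" "cat_functor VModPreCls VPreCls forget_V"
  using category_UV category_V category_UVMod category_VMod
  unfolding cat_defs forget_V_def
  by (auto intro!: cat_functor_set_ftor simp: uv_mod_mor_iff cls_mod_mor_iff)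

lemma N_uv_conv: "N_uv = set_ftor (\<lambda>(A, \<alpha>). (A, uv_induced A \<alpha>, \<alpha>))"
  unfolding N_uv_def uv_induced_def ..

lemma N_cls_conv: "N_cls = set_ftor (\<lambda>(A, \<delta>). (A, cls_induced A \<delta>, \<delta>))"
  unfolding N_cls_def cls_induced_def ..

lemma cat_functor_N:
  "cat_functor UVCat UVModCat N_uv" "cat_functor VCls VModCls N_cls"
  using category_UV category_V category_UVMod category_VMod
  unfolding cat_defs N_uv_conv N_cls_conv
  by (auto intro!: cat_functor_set_ftor simp: uv_mod_mor_iff cls_mod_mor_iff
      vcategory_uv_induced uv_modular_uv_induced vfunctor_uv_induced
      vcategory_cls_induced cls_modular_cls_induced vfunctor_cls_induced)

lemma adjunction_forget_V_N:
  "adjunction UVModCat UVCat forget_V N_uv idmap idmap"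
  "adjunction VModCls VCls forget_V N_cls idmap idmap"
  using cat_functor_forget_V cat_functor_N
  unfolding cat_defs forget_V_def N_uv_conv N_cls_conv
  by (auto intro!: adjunction_set_ftor vfunctor_idI uv_mor_idI cls_mor_idI
      simp: uv_mod_mor_iff cls_mod_mor_iff le_uv_induced le_cls_induced)

context
  assumes cd: "completely_distributive TYPE('v::quantale)"
begin

lemma cat_functor_eps:
  "cat_functor (UVCat :: (('a, 'v) uv_obj, _) precat) VCls eps"
  "cat_functor (UVUGph :: (('a, 'v) uv_obj, _) precat) VPreCls eps"
  using category_UV category_V unfolding cat_defs eps_def
  by (auto intro!: cat_functor_set_ftor
      simp: closure_space_eps_str[OF cd] preclosure_eps_str cls_mor_eps_str)

lemma cat_functor_Rfun:
  "cat_functor (VCls :: (('a, 'v) cls_obj, _) precat) UVCat Rfun"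
  "cat_functor (VPreCls :: (('a, 'v) cls_obj, _) precat) UVUGph Rfun"
  using category_UV category_V unfolding cat_defs Rfun_def
  by (auto intro!: cat_functor_set_ftor
      simp: uv_category_R_str[OF cd] uv_graph_R_str uv_mor_R_str closure_space_imp_preclosure)

lemma cat_functor_eps_bar:
  "cat_functor (UVModCat :: (('a, 'v) uv_mod_obj, _) precat) VModCls eps_bar"
  "cat_functor (UVModUGph :: (('a, 'v) uv_mod_obj, _) precat) VModPreCls eps_bar"
  "cat_functor (UVModCat :: (('a, 'v) uv_mod_obj, _) precat) VModTop eps_bar"
  "cat_functor (UVModUGph :: (('a, 'v) uv_mod_obj, _) precat) VModPreTop eps_bar"
  using category_UVMod category_VMod category_VModTop unfolding cat_defs eps_bar_def
  by (auto intro!: cat_functor_set_ftor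
      simp: closure_space_eps_str[OF cd] preclosure_eps_str cls_modular_eps_str[OF cd]
        eps_str_preserves_finite_joins cls_mor_eps_str uv_mod_mor_iff cls_mod_mor_iff)

lemma cat_functor_R_bar:
  "cat_functor (VModCls :: (('a, 'v) cls_mod_obj, _) precat) UVModCat R_bar"
  "cat_functor (VModPreCls :: (('a, 'v) cls_mod_obj, _) precat) UVModUGph R_bar"
  "cat_functor (VModTop :: (('a, 'v) cls_mod_obj, _) precat) UVModCat R_bar"
  "cat_functor (VModPreTop :: (('a, 'v) cls_mod_obj, _) precat) UVModUGph R_bar"
  using category_UVMod category_VMod category_VModTop unfolding cat_defs R_bar_def
  by (auto intro!: cat_functor_set_ftor
      simp: uv_category_R_str[OF cd] uv_graph_R_str uv_modular_R_str[OF cd]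
        uv_mor_R_str closure_space_imp_preclosure uv_mod_mor_iff cls_mod_mor_iff)

lemma adjunction_eps_Rfun:
  "adjunction (UVCat :: (('a, 'v) uv_obj, _) precat) VCls eps Rfun idmap idmap"
  "adjunction (UVUGph :: (('a, 'v) uv_obj, _) precat) VPreCls eps Rfun idmap idmap"
  using cat_functor_eps cat_functor_Rfun unfolding cat_defs eps_def Rfun_def
  by (auto intro!: adjunction_set_ftor uv_mor_idI cls_mor_idI
      simp: le_R_str_eps_str eps_str_R_str_le)

lemma adjunction_eps_bar_R_bar:
  "adjunction (UVModCat :: (('a, 'v) uv_mod_obj, _) precat) VModCls eps_bar R_bar idmap idmap"
  "adjunction (UVModUGph :: (('a, 'v) uv_mod_obj, _) precat) VModPreCls eps_bar R_bar idmap idmap"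
  using cat_functor_eps_bar(1,2) cat_functor_R_bar(1,2) unfolding cat_defs eps_bar_def R_bar_def
  by (auto intro!: adjunction_set_ftor uv_mor_idI cls_mor_idI vfunctor_idI
      simp: le_R_str_eps_str eps_str_R_str_le uv_mod_mor_iff cls_mod_mor_iff)

lemma forget_V_eps_bar:
  "functor_eq (UVModCat :: (('a, 'v) uv_mod_obj, _) precat) VCls
    (forget_V \<circ>\<^sub>F eps_bar) (eps \<circ>\<^sub>F forget_V)"
  "functor_eq (UVModUGph :: (('a, 'v) uv_mod_obj, _) precat) VPreCls
    (forget_V \<circ>\<^sub>F eps_bar) (eps \<circ>\<^sub>F forget_V)"
  using cat_functor_fcomp[OF cat_functor_eps_bar(1) cat_functor_forget_V(3)]
    cat_functor_fcomp[OF cat_functor_eps_bar(2) cat_functor_forget_V(4)]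
  unfolding forget_V_def eps_bar_def eps_def fcomp_set_ftor
  by (auto intro!: functor_eq_set_ftor)

lemma forget_V_R_bar:
  "functor_eq (VModCls :: (('a, 'v) cls_mod_obj, _) precat) UVCat
    (forget_V \<circ>\<^sub>F R_bar) (Rfun \<circ>\<^sub>F forget_V)"
  "functor_eq (VModPreCls :: (('a, 'v) cls_mod_obj, _) precat) UVUGph
    (forget_V \<circ>\<^sub>F R_bar) (Rfun \<circ>\<^sub>F forget_V)"
  using cat_functor_fcomp[OF cat_functor_R_bar(1) cat_functor_forget_V(1)]
    cat_functor_fcomp[OF cat_functor_R_bar(2) cat_functor_forget_V(2)]
  unfolding forget_V_def R_bar_def Rfun_def fcomp_set_ftor
  by (auto intro!: functor_eq_set_ftor)

lemma eps_bar_N: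
  "functor_eq (UVCat :: (('a, 'v) uv_obj, _) precat) VModCls
    (eps_bar \<circ>\<^sub>F N_uv) (N_cls \<circ>\<^sub>F eps)"
  using cat_functor_fcomp[OF cat_functor_N(1) cat_functor_eps_bar(1)]
  unfolding eps_bar_def N_uv_conv N_cls_conv eps_def fcomp_set_ftor
  by (auto intro!: functor_eq_set_ftor simp: cls_induced_eps_str)

lemma cat_iso_eps_bar_R_bar:
  "cat_iso (UVModCat :: (('a, 'v) uv_mod_obj, _) precat) VModTop eps_bar R_bar"
  "cat_iso (UVModUGph :: (('a, 'v) uv_mod_obj, _) precat) VModPreTop eps_bar R_bar"
  using cat_functor_eps_bar(3,4) cat_functor_R_bar(3,4) unfolding cat_defs eps_bar_def R_bar_def
  by (auto intro!: cat_iso_set_ftor simp: set_cat_simps R_str_eps_str[OF cd] eps_str_R_str[OF cd]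
      uv_category_imp_uv_graph closure_space_imp_preclosure)

end

theorem theorem4p5:
  assumes "completely_distributive TYPE('v::quantale)"
  shows
    "adjunction (UVCat :: (('a, 'v) uv_obj, _) precat) VCls eps Rfun idmap idmap \<and>
     adjunction (UVUGph :: (('a, 'v) uv_obj, _) precat) VPreCls eps Rfun idmap idmap \<and>
     adjunction (UVModCat :: (('a, 'v) uv_mod_obj, _) precat) VModCls eps_bar R_bar idmap idmap \<and>
     adjunction (UVModUGph :: (('a, 'v) uv_mod_obj, _) precat) VModPreCls eps_bar R_bar idmap idmap \<and>

     cat_functor (UVModUGph :: (('a, 'v) uv_mod_obj, _) precat) UVUGph forget_V \<and>
     cat_functor (VModPreCls :: (('a, 'v) cls_mod_obj, _) precat) VPreCls forget_V \<and>
     adjunction (UVModCat :: (('a, 'v) uv_mod_obj, _) precat) UVCat forget_V N_uv idmap idmap \<and>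
     adjunction (VModCls :: (('a, 'v) cls_mod_obj, _) precat) VCls forget_V N_cls idmap idmap \<and>

     functor_eq (UVModCat :: (('a, 'v) uv_mod_obj, _) precat) VCls
       (forget_V \<circ>\<^sub>F eps_bar) (eps \<circ>\<^sub>F forget_V) \<and>
     functor_eq (VModCls :: (('a, 'v) cls_mod_obj, _) precat) UVCat
       (forget_V \<circ>\<^sub>F R_bar) (Rfun \<circ>\<^sub>F forget_V) \<and>
     functor_eq (UVModUGph :: (('a, 'v) uv_mod_obj, _) precat) VPreCls
       (forget_V \<circ>\<^sub>F eps_bar) (eps \<circ>\<^sub>F forget_V) \<and>
     functor_eq (VModPreCls :: (('a, 'v) cls_mod_obj, _) precat) UVUGph
       (forget_V \<circ>\<^sub>F R_bar) (Rfun \<circ>\<^sub>F forget_V) \<and>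

     functor_eq (UVCat :: (('a, 'v) uv_obj, _) precat) VModCls
       (eps_bar \<circ>\<^sub>F N_uv) (N_cls \<circ>\<^sub>F eps) \<and>

     cat_iso (UVModCat :: (('a, 'v) uv_mod_obj, _) precat) VModTop eps_bar R_bar \<and>
     cat_iso (UVModUGph :: (('a, 'v) uv_mod_obj, _) precat) VModPreTop eps_bar R_bar"
  by (intro conjI adjunction_eps_Rfun[OF assms] adjunction_eps_bar_R_bar[OF assms]
      cat_functor_forget_V adjunction_forget_V_N forget_V_eps_bar[OF assms]
      forget_V_R_bar[OF assms] eps_bar_N[OF assms] cat_iso_eps_bar_R_bar[OF assms])

end
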